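(* For every rearrangement invariant space $X$ on $(0,\infty)$ and all $n\in\mathbb Z$ we have: (i) $\|\tau_n\|_{E_X\to E_X}\le\|\sigma_{2^n}\|_{X\to X}\le2\|\tau_n\|_{E_X\to E_X}$; (ii) $\|\tau_n^0\|_{E_X\to E_X}\le\|\sigma_{2^n}^0\|_{X\to X}\le2\|\tau_n^0\|_{E_X\to E_X}$; (iii) $\frac12\|\tau_n^\infty\|_{E_X\to E_X}\le\|\sigma_{2^n}^\infty\|_{X\to X}\le4\|\tau_n^\infty\|_{E_X\to E_X}$. Hence, $\alpha_X=\gamma_{E_X}$, $\alpha_X^0=\gamma_{E_X}^0$, $\alpha_X^\infty=\gamma_{E_X}^\infty$, $\beta_X=\delta_{E_X}$, $\beta_X^0=\delta_{E_X}^0$ and $\beta_X^\infty=\delta_{E_X}^\infty$.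
   Context: R.i. spaces. Let $m$ be Lebesgue measure on $(0,\infty)$. A Banach function lattice on $(0,\infty)$ is a Banach space $E$ of (classes of) a.e. finite real measurable functions such that $x\in E$, $y$ measurable, $|y|\le|x|$ a.e. imply $y\in E$ and $\|y\|_E\le\|x\|_E$. For measurable $f$, $f^*(t)=\inf\{\tau\ge0:m\{s:|f(s)|>\tau\}\le t\}$. A rearrangement invariant (r.i.) space $X$ on $(0,\infty)$ is a Banach function lattice such that $f\in X$, $g$ measurable, $g^*\le f^*$ imply $g\in X$, $\|g\|_X\le\|f\|_X$. Standing assumptions: $X$ is separable or has the Fatou property (if $x_n\in X$, $\sup_n\|x_n\|_X<\infty$, $x$ is measurable and a.e. finite, and $x_n\to x$ a.e., then $x\in X$ and $\|x\|_X\le\liminf_n\|x_n\|_X$), and $\|\chi_{[0,1]}\|_X=1$. Dilation operators and indices of $X$. For $\tau>0$ put $\sigma_\tau x(t)=x(t/\tau)$, $t>0$, and $\sigma_\tau^0x=\chi_{[0,1]}\,\sigma_\tau(x\chi_{[0,1]})$. Let $\mathcal G_X$ be the set of all $f\in X$ of the form $f=c\chi_{[1,2]}+g$ with $c>0$, $\mathrm{supp}\,g\subset(2,\infty)$, $|g|\le c$; for integers $n\le0$ let $\mathcal G_X^n=\{f\in X:\sigma_{2^n}f\in\mathcal G_X\}$. The operator $\sigma_{2^n}^\infty$ is the restriction of $\sigma_{2^n}$ to $\mathcal G_X^n$ if $n\le0$ and to $\mathcal G_X$ if $n\ge0$, and $\|\sigma_{2^n}^\infty\|_{X\to X}$ denotes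 the supremum of $\|\sigma_{2^n}f\|_X/\|f\|_X$ over $f$ in that set. Define $$\alpha_X=-\lim_{n\to\infty}\tfrac1n\log_2\|\sigma_{2^{-n}}\|_{X\to X},\qquad\beta_X=\lim_{n\to\infty}\tfrac1n\log_2\|\sigma_{2^n}\|_{X\to X},$$ and define $\alpha_X^0,\beta_X^0$ (resp. $\alpha_X^\infty,\beta_X^\infty$) by the same formulas with $\sigma$ replaced by $\sigma^0$ (resp. $\sigma^\infty$). The sequence lattice $E_X$. Let $\Delta_k=[2^k,2^{k+1})$, $k\in\mathbb Z$. For a real sequence $a=(a_k)_{k\in\mathbb Z}$ put $Sa=\sum_{k\in\mathbb Z}a_k\chi_{\Delta_k}$. $E_X$ is the Banach sequence lattice of all $a$ with $Sa\in X$, with norm $\|a\|_{E_X}=\|Sa\|_X$. Shift operators and shift exponents. $\tau_na=(a_{k-n})_{k\in\mathbb Z}$. With $\mathbb Z_-=\{k\in\mathbb Z:k\le0\}$ and $\mathbb Z_+=\{k\in\mathbb Z:k\ge0\}$, put $\tau_n^0a=\chi_{\mathbb Z_-}\cdot\tau_n(a\chi_{\mathbb Z_-})$ and $\tau_n^\infty a=\chi_{\mathbb Z_+}\cdot\tau_n(a\chi_{\mathbb Z_+})$. For a Banach sequence lattice $E$ on $\mathbb Z$ in which all $\tau_n$ are bounded, $$\gamma_E=-\lim_{n\to\infty}\tfrac1n\log_2\|\tau_{-n}\|_{E\to E},\qquad\delta_E=\lim_{n\to\infty}\tfrac1n\log_2\|\tau_n\|_{E\to E},$$ and $\gamma_E^0,\delta_E^0$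 (resp. $\gamma_E^\infty,\delta_E^\infty$) are defined by the same formulas with $\tau$ replaced by $\tau^0$ (resp. $\tau^\infty$).
   Formalization: The left inequality of (ii) is false for Z_- = {k≤0} (take ‖f‖ = ∫_0^1 f^*, n = -1, a = χ_{k≤0}); it is proved with the factor 1/2 on ‖τ_n^0‖, and with constant 1 for the truncation to {k<0}. *)

theory Defs
  imports "HOL-Analysis.Analysis"
begin

section \<open>Function spaces on the half-line\<close>

text \<open>
  A space is a set of functions together with a real-valued norm, which is meaningful on that set
  only.  Functions are representatives of their almost-everywhere classes: the ideal property below
  makes the set closed under a.e. equality and the norm invariant under it, and the values of a
  function on the nonpositive reals never matter.
\<close>

abbreviation half_line :: "real measure" where
  "half_line \<equiv> lebesgue_on {0<..}"

locale banach_function_lattice =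
  fixes X :: "(real \<Rightarrow> real) set" and nrm :: "(real \<Rightarrow> real) \<Rightarrow> real"
  assumes measurable: "f \<in> X \<Longrightarrow> f \<in> borel_measurable half_line"
    and zero: "(\<lambda>t. 0) \<in> X"
    and add: "\<lbrakk>f \<in> X; g \<in> X\<rbrakk> \<Longrightarrow> (\<lambda>t. f t + g t) \<in> X"
    and scale: "f \<in> X \<Longrightarrow> (\<lambda>t. c * f t) \<in> X"
    and nrm_nonneg: "f \<in> X \<Longrightarrow> 0 \<le> nrm f"
    and nrm_eq_0_iff: "f \<in> X \<Longrightarrow> nrm f = 0 \<longleftrightarrow> (AE t in half_line. f t = 0)"
    and nrm_triangle: "\<lbrakk>f \<in> X; g \<in> X\<rbrakk> \<Longrightarrow> nrm (\<lambda>t. f t + g t) \<le> nrm f + nrm g"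
    and nrm_scale: "f \<in> X \<Longrightarrow> nrm (\<lambda>t. c * f t) = \<bar>c\<bar> * nrm f"
    and complete: "\<lbrakk>\<And>i. u i \<in> X;
        \<And>e. e > 0 \<Longrightarrow> \<exists>M. \<forall>i\<ge>M. \<forall>j\<ge>M. nrm (\<lambda>t. u i t - u j t) < e\<rbrakk>
      \<Longrightarrow> \<exists>f\<in>X. (\<lambda>i. nrm (\<lambda>t. u i t - f t)) \<longlonglongrightarrow> 0"
    and ideal: "\<lbrakk>x \<in> X; y \<in> borel_measurable half_line; AE t in half_line. \<bar>y t\<bar> \<le> \<bar>x t\<bar>\<rbrakk>
      \<Longrightarrow> y \<in> X \<and> nrm y \<le> nrm x"

text \<open>
  The rearrangement is taken in the extended nonnegative reals: it is infinite at \<open>t\<close> when no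
  admissible level exists (over the reals that infimum would be unspecified).
\<close>

definition rearrangement :: "(real \<Rightarrow> real) \<Rightarrow> real \<Rightarrow> ennreal" where
  "rearrangement f t = (INF \<tau>\<in>{\<tau>::real. 0 \<le> \<tau> \<and>
     emeasure half_line {s \<in> space half_line. \<bar>f s\<bar> > \<tau>} \<le> ennreal t}. ennreal \<tau>)"

locale ri_space = banach_function_lattice +
  assumes rearrangement_invariant:
    "\<lbrakk>f \<in> X; g \<in> borel_measurable half_line; \<And>t. t > 0 \<Longrightarrow> rearrangement g t \<le> rearrangement f t\<rbrakk>
      \<Longrightarrow> g \<in> X \<and> nrm g \<le> nrm f"

definition separable_norm :: "(real \<Rightarrow> real) set \<Rightarrow> ((real \<Rightarrow> real) \<Rightarrow> real) \<Rightarrow> bool" where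
  "separable_norm X nrm \<longleftrightarrow>
     (\<exists>D. countable D \<and> D \<subseteq> X \<and> (\<forall>f\<in>X. \<forall>e>0. \<exists>d\<in>D. nrm (\<lambda>t. f t - d t) < e))"

definition fatou_property :: "(real \<Rightarrow> real) set \<Rightarrow> ((real \<Rightarrow> real) \<Rightarrow> real) \<Rightarrow> bool" where
  "fatou_property X nrm \<longleftrightarrow>
     (\<forall>u x. (\<forall>i::nat. u i \<in> X) \<longrightarrow> bdd_above (range (\<lambda>i. nrm (u i))) \<longrightarrow>
        x \<in> borel_measurable half_line \<longrightarrow> (AE t in half_line. (\<lambda>i. u i t) \<longlonglongrightarrow> x t) \<longrightarrow>
        x \<in> X \<and> ereal (nrm x) \<le> liminf (\<lambda>i. ereal (nrm (u i))))"


section \<open>Operator norms and exponents\<close>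

text \<open>
  Supremum of \<open>\<parallel>T f\<parallel> / \<parallel>f\<parallel>\<close> over the nonzero \<open>f\<close> in \<open>D\<close>, where \<open>\<parallel>T f\<parallel> = \<infinity>\<close> if \<open>T f\<close> lies
  outside the space \<open>X\<close>.
\<close>

definition op_norm_on :: "'f set \<Rightarrow> ('f \<Rightarrow> real) \<Rightarrow> 'f set \<Rightarrow> ('f \<Rightarrow> 'f) \<Rightarrow> ennreal" where
  "op_norm_on X nrm D T =
     (SUP f\<in>{f \<in> D. nrm f \<noteq> 0}. if T f \<in> X then ennreal (nrm (T f) / nrm f) else \<infinity>)"

definition lower_exponent :: "(int \<Rightarrow> ennreal) \<Rightarrow> real" where
  "lower_exponent w = - lim (\<lambda>n::nat. log 2 (enn2real (w (- int n))) / real n)"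

definition upper_exponent :: "(int \<Rightarrow> ennreal) \<Rightarrow> real" where
  "upper_exponent w = lim (\<lambda>n::nat. log 2 (enn2real (w (int n))) / real n)"

text \<open>
  Both exponents are meaningful only if the following holds; otherwise \<^const>\<open>lim\<close>,
  \<^const>\<open>log\<close> or \<^const>\<open>enn2real\<close> may return a default value.
\<close>

definition exponents_exist :: "(int \<Rightarrow> ennreal) \<Rightarrow> bool" where
  "exponents_exist w \<longleftrightarrow>
     (\<forall>n. 0 < w n \<and> w n < \<infinity>) \<and>
     convergent (\<lambda>n::nat. log 2 (enn2real (w (- int n))) / real n) \<and>
     convergent (\<lambda>n::nat. log 2 (enn2real (w (int n))) / real n)"


section \<open>Dilations\<close>

definition dilation :: "real \<Rightarrow> (real \<Rightarrow> real) \<Rightarrow> real \<Rightarrow> real" where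
  "dilation \<tau> x t = x (t / \<tau>)"

definition dilation0 :: "real \<Rightarrow> (real \<Rightarrow> real) \<Rightarrow> real \<Rightarrow> real" where
  "dilation0 \<tau> x t = indicator {0..1} t * dilation \<tau> (\<lambda>s. x s * indicator {0..1} s) t"

definition G_set :: "(real \<Rightarrow> real) set \<Rightarrow> (real \<Rightarrow> real) set" where
  "G_set X = {f \<in> X. \<exists>c g. c > 0 \<and> g \<in> borel_measurable half_line \<and>
      (\<forall>t. t \<notin> {2<..} \<longrightarrow> g t = 0) \<and> (\<forall>t. \<bar>g t\<bar> \<le> c) \<and>
      (AE t in half_line. f t = c * indicator {1..2} t + g t)}"

definition dilation_inf_dom :: "(real \<Rightarrow> real) set \<Rightarrow> int \<Rightarrow> (real \<Rightarrow> real) set" where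
  "dilation_inf_dom X n =
     (if n \<le> 0 then {f \<in> X. dilation (2 powi n) f \<in> G_set X} else G_set X)"

definition dil_norm ::
    "(real \<Rightarrow> real) set \<Rightarrow> ((real \<Rightarrow> real) \<Rightarrow> real) \<Rightarrow> int \<Rightarrow> ennreal" where
  "dil_norm X nrm n = op_norm_on X nrm X (dilation (2 powi n))"

definition dil0_norm ::
    "(real \<Rightarrow> real) set \<Rightarrow> ((real \<Rightarrow> real) \<Rightarrow> real) \<Rightarrow> int \<Rightarrow> ennreal" where
  "dil0_norm X nrm n = op_norm_on X nrm X (dilation0 (2 powi n))"

definition dil_inf_norm ::
    "(real \<Rightarrow> real) set \<Rightarrow> ((real \<Rightarrow> real) \<Rightarrow> real) \<Rightarrow> int \<Rightarrow> ennreal" where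
  "dil_inf_norm X nrm n = op_norm_on X nrm (dilation_inf_dom X n) (dilation (2 powi n))"


section \<open>Sequence lattices and shifts\<close>

definition dyadic :: "int \<Rightarrow> real set" where
  "dyadic k = {2 powi k ..< 2 powi (k + 1)}"

definition step_fun :: "(int \<Rightarrow> real) \<Rightarrow> real \<Rightarrow> real" where
  "step_fun a t = (\<Sum>\<^sub>\<infinity>k\<in>UNIV. a k * indicator (dyadic k) t)"

definition seq_space :: "(real \<Rightarrow> real) set \<Rightarrow> (int \<Rightarrow> real) set" where
  "seq_space X = {a. step_fun a \<in> X}"

definition seq_norm :: "((real \<Rightarrow> real) \<Rightarrow> real) \<Rightarrow> (int \<Rightarrow> real) \<Rightarrow> real" where
  "seq_norm nrm a = nrm (step_fun a)"

definition shift :: "int \<Rightarrow> (int \<Rightarrow> real) \<Rightarrow> int \<Rightarrow> real" where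
  "shift n a k = a (k - n)"

definition trunc_shift :: "int set \<Rightarrow> int \<Rightarrow> (int \<Rightarrow> real) \<Rightarrow> int \<Rightarrow> real" where
  "trunc_shift A n a k = indicator A k * shift n (\<lambda>j. a j * indicator A j) k"

definition shift_norm ::
    "(int \<Rightarrow> real) set \<Rightarrow> ((int \<Rightarrow> real) \<Rightarrow> real) \<Rightarrow> int \<Rightarrow> ennreal" where
  "shift_norm E nrm n = op_norm_on E nrm E (shift n)"

definition trunc_shift_norm ::
    "int set \<Rightarrow> (int \<Rightarrow> real) set \<Rightarrow> ((int \<Rightarrow> real) \<Rightarrow> real) \<Rightarrow> int \<Rightarrow> ennreal" where
  "trunc_shift_norm A E nrm n = op_norm_on E nrm E (trunc_shift A n)"

abbreviation shift0_norm ::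
    "(int \<Rightarrow> real) set \<Rightarrow> ((int \<Rightarrow> real) \<Rightarrow> real) \<Rightarrow> int \<Rightarrow> ennreal" where
  "shift0_norm \<equiv> trunc_shift_norm {..0}"

text \<open>
  The union of the dyadic intervals over \<open>k \<le> 0\<close> is \<open>(0,2)\<close>, whereas \<^const>\<open>dilation0\<close> lives on
  \<open>[0,1]\<close>, which corresponds to \<open>k < 0\<close>.  So \<^term>\<open>shift0_norm E nrm n\<close> can be twice the norm of
  the dilation: in \<open>L\<^sup>1 + L\<^sup>\<infinity>\<close> with norm \<open>\<integral>\<^sub>0\<^sup>1 f\<^sup>*\<close> the sequence \<open>a = \<chi>\<^bsub>{k \<le> 0}\<^esub>\<close> shows that it
  is at least \<open>1\<close> for \<open>n = -1\<close>, while the dilation on \<open>[0,1]\<close> has norm \<open>1/2\<close>.  The estimate with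
  constant \<open>1\<close> holds for the truncation to \<open>k < 0\<close>.
\<close>

abbreviation shift_neg_norm ::
    "(int \<Rightarrow> real) set \<Rightarrow> ((int \<Rightarrow> real) \<Rightarrow> real) \<Rightarrow> int \<Rightarrow> ennreal" where
  "shift_neg_norm \<equiv> trunc_shift_norm {..<0}"

abbreviation shift_inf_norm ::
    "(int \<Rightarrow> real) set \<Rightarrow> ((int \<Rightarrow> real) \<Rightarrow> real) \<Rightarrow> int \<Rightarrow> ennreal" where
  "shift_inf_norm \<equiv> trunc_shift_norm {0..}"


section \<open>Dilation indices and shift exponents\<close>

definition alpha_index :: "(real \<Rightarrow> real) set \<Rightarrow> ((real \<Rightarrow> real) \<Rightarrow> real) \<Rightarrow> real" where
  "alpha_index X nrm = lower_exponent (dil_norm X nrm)"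
definition beta_index :: "(real \<Rightarrow> real) set \<Rightarrow> ((real \<Rightarrow> real) \<Rightarrow> real) \<Rightarrow> real" where
  "beta_index X nrm = upper_exponent (dil_norm X nrm)"
definition alpha0_index :: "(real \<Rightarrow> real) set \<Rightarrow> ((real \<Rightarrow> real) \<Rightarrow> real) \<Rightarrow> real" where
  "alpha0_index X nrm = lower_exponent (dil0_norm X nrm)"
definition beta0_index :: "(real \<Rightarrow> real) set \<Rightarrow> ((real \<Rightarrow> real) \<Rightarrow> real) \<Rightarrow> real" where
  "beta0_index X nrm = upper_exponent (dil0_norm X nrm)"
definition alpha_inf_index :: "(real \<Rightarrow> real) set \<Rightarrow> ((real \<Rightarrow> real) \<Rightarrow> real) \<Rightarrow> real" where
  "alpha_inf_index X nrm = lower_exponent (dil_inf_norm X nrm)"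
definition beta_inf_index :: "(real \<Rightarrow> real) set \<Rightarrow> ((real \<Rightarrow> real) \<Rightarrow> real) \<Rightarrow> real" where
  "beta_inf_index X nrm = upper_exponent (dil_inf_norm X nrm)"

definition gamma_exp :: "(int \<Rightarrow> real) set \<Rightarrow> ((int \<Rightarrow> real) \<Rightarrow> real) \<Rightarrow> real" where
  "gamma_exp E nrm = lower_exponent (shift_norm E nrm)"
definition delta_exp :: "(int \<Rightarrow> real) set \<Rightarrow> ((int \<Rightarrow> real) \<Rightarrow> real) \<Rightarrow> real" where
  "delta_exp E nrm = upper_exponent (shift_norm E nrm)"
definition gamma0_exp :: "(int \<Rightarrow> real) set \<Rightarrow> ((int \<Rightarrow> real) \<Rightarrow> real) \<Rightarrow> real" where
  "gamma0_exp E nrm = lower_exponent (shift0_norm E nrm)"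
definition delta0_exp :: "(int \<Rightarrow> real) set \<Rightarrow> ((int \<Rightarrow> real) \<Rightarrow> real) \<Rightarrow> real" where
  "delta0_exp E nrm = upper_exponent (shift0_norm E nrm)"
definition gamma_inf_exp :: "(int \<Rightarrow> real) set \<Rightarrow> ((int \<Rightarrow> real) \<Rightarrow> real) \<Rightarrow> real" where
  "gamma_inf_exp E nrm = lower_exponent (shift_inf_norm E nrm)"
definition delta_inf_exp :: "(int \<Rightarrow> real) set \<Rightarrow> ((int \<Rightarrow> real) \<Rightarrow> real) \<Rightarrow> real" where
  "delta_inf_exp E nrm = upper_exponent (shift_inf_norm E nrm)"

end

theory Submission
  imports Defs
begin

text \<open>
  All three norm estimates rest on one observation: a rearrangement invariant norm only sees the
  distribution function \<open>d\<^sub>f(\<tau>) = m{|f| > \<tau>}\<close>, and it is monotone in it (\<open>distr_fun_le_imp\<close>).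
  The dilation \<open>\<sigma>\<close> by a factor \<open>c\<close> multiplies the distribution function by \<open>c\<close>, and dilation by \<open>2\<^sup>n\<close> is
  exactly the shift \<open>\<tau>\<^sub>n\<close> on dyadic step functions. Hence restricting a dilation to step functions gives the
  lower estimates on the half-line and near zero, and for the upper estimates it suffices to replace a general \<open>x\<close> by a
  step function \<open>Sa\<close> with \<open>d\<^sub>x \<le> d\<^bsub>Sa\<^esub>\<close> whose norm is controlled by that of \<open>x\<close>.

  The sequence \<open>a\<^sub>k = x\<^sup>*(2\<^sup>k)\<close> does this: \<open>d\<^sub>x \<le> d\<^bsub>Sa\<^esub> \<le> 2 d\<^sub>x\<close> (\<open>step_fun_rearr\<close>). The factor 2 in the
  distribution costs only a factor 2 in the norm, because \<open>Sa\<close> is the sum of its restrictions to the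
  left and to the right halves of the dyadic intervals, and each of these has half the distribution
  function of \<open>Sa\<close> (\<open>step_fun_double\<close>). The same sequence serves near zero, where both the dilated function and
  the truncated step function are compared with \<open>min(1, 2\<^sup>n, 2\<^sup>n d\<^sub>x)\<close>.

  Near infinity the admissible functions are \<open>c\<close> on \<open>[1,2]\<close> and at most \<open>c\<close> afterwards, so their
  distribution function has no values strictly between 0 and 1. This gap compensates for discarding the
  intervals below 1: the sequence \<open>k \<mapsto> x\<^sup>*(2\<^bsup>k-1\<^esup>)\<close>, \<open>k \<ge> 0\<close>, dominates \<open>x\<close> at the price of a factor 4
  (\<open>step_fun_rearr_nonneg_part\<close>). Conversely, any function with such a gap is
  equimeasurable with an admissible one, namely \<open>t \<mapsto> w\<^sup>*(t - 1)\<close> on \<open>(1,\<infinity>)\<close>, which is constant on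
  \<open>(1,2)\<close> precisely because of the gap (\<open>equimeasurable_G_set\<close>).

  For the exponents, comparable families have the same exponents after taking logarithms and
  dividing by \<open>n\<close>, so existence is needed on the sequence side only. There the truncations to order convex
  index sets satisfy \<open>\<tau>\<^bsub>m+n\<^esub> = \<tau>\<^sub>m \<tau>\<^sub>n\<close> for \<open>m\<close> and \<open>n\<close> of equal sign, the norms are submultiplicative, and
  Fekete's lemma applies.
\<close>

section \<open>Distribution functions on the half-line\<close>

definition distr_fun :: "(real \<Rightarrow> real) \<Rightarrow> real \<Rightarrow> ennreal" where
  "distr_fun f \<tau> = emeasure half_line {s \<in> space half_line. \<bar>f s\<bar> > \<tau>}"

lemma sets_half_line_iff:
  "A \<in> sets half_line \<longleftrightarrow> A \<in> sets lebesgue \<and> A \<subseteq> {0<..}"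
  by (auto simp: sets_restrict_space_iff)

lemma emeasure_half_line: "A \<subseteq> {0<..} \<Longrightarrow> emeasure half_line A = emeasure lebesgue A"
  by (rule emeasure_restrict_space) auto

lemma AE_half_line_neq: "AE t in half_line. t \<noteq> c"
proof -
  have "AE t in lebesgue. t \<noteq> c"
    by (intro AE_completion AE_lborel_singleton)
  then show ?thesis
    by (subst AE_restrict_space_iff) (auto elim: eventually_mono)
qed

lemma sets_superlevel:
  fixes f :: "real \<Rightarrow> real"
  assumes "f \<in> borel_measurable half_line"
  shows "{s. 0 < s \<and> \<tau> < \<bar>f s\<bar>} \<in> sets half_line"
proof -
  have "(\<lambda>s. \<bar>f s\<bar>) \<in> borel_measurable half_line"
    using assms by (rule borel_measurable_abs)
  then have "{s \<in> space half_line. \<tau> < \<bar>f s\<bar>} \<in> sets half_line"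
    by (simp add: borel_measurable_iff_greater)
  then show ?thesis by simp
qed

lemma distr_fun_eq: "distr_fun f \<tau> = emeasure half_line {s. 0 < s \<and> \<tau> < \<bar>f s\<bar>}"
  by (simp add: distr_fun_def)

text \<open>
  Level sets of decreasing functions are compared below with sets of this form, with the threshold \<open>D\<close> a value
  of a distribution function. Keeping \<open>D\<close> extended real covers sets of infinite measure, and the
  offset \<open>c\<close> serves the functions that live on \<open>(1,\<infinity>)\<close>.
\<close>

lemma emeasure_shifted_initial:
  assumes "0 \<le> c"
  shows "emeasure half_line {t. c < t \<and> ennreal (t - c) < D} = D"
    and "{t. c < t \<and> ennreal (t - c) < D} \<in> sets half_line"
proof -
  have fin: "{t. c < t \<and> ennreal (t - c) < ennreal r} = {c<..<c + r}" if "r \<ge> 0" for r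
    using that by (auto simp: ennreal_less_iff)
  have "emeasure half_line {t. c < t \<and> ennreal (t - c) < D} = D
      \<and> {t. c < t \<and> ennreal (t - c) < D} \<in> sets half_line"
  proof (cases D)
    case (real r)
    have "{c<..<c + r} \<subseteq> {0<..}" using assms by auto
    then show ?thesis
      using real by (simp add: fin emeasure_half_line sets_half_line_iff)
  next
    case top
    have ge: "ennreal (real n) \<le> emeasure half_line {c<..}" for n
    proof -
      have "ennreal (real n) = emeasure lebesgue {c<..<c + real n}" by simp
      also have "\<dots> = emeasure half_line {c<..<c + real n}"
        using assms by (subst emeasure_half_line) auto
      also have "\<dots> \<le> emeasure half_line {c<..}"
        using assms by (intro emeasure_mono) (auto simp: sets_half_line_iff)
      finally show ?thesis .
    qed
    have "emeasure half_line {c<..} = top"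
    proof (cases "emeasure half_line {c<..}")
      case (real r)
      obtain n where "r < real n" using reals_Archimedean2 by blast
      with ge[of n] real show ?thesis by simp
    qed
    moreover have "{t. c < t \<and> ennreal (t - c) < D} = {c<..}"
      using top by auto
    ultimately show ?thesis using top assms by (simp add: sets_half_line_iff)
  qed
  then show "emeasure half_line {t. c < t \<and> ennreal (t - c) < D} = D"
    "{t. c < t \<and> ennreal (t - c) < D} \<in> sets half_line" by auto
qed

lemma emeasure_initial:
  "emeasure half_line {t. 0 < t \<and> ennreal t < D} = D"
  "{t. 0 < t \<and> ennreal t < D} \<in> sets half_line"
  using emeasure_shifted_initial[of 0 D] by simp_all

lemma distr_fun_leI:
  assumes "\<And>t. \<lbrakk>0 < t; \<tau> < \<bar>f t\<bar>\<rbrakk> \<Longrightarrow> ennreal t < D"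
  shows "distr_fun f \<tau> \<le> D"
proof -
  have "distr_fun f \<tau> \<le> emeasure half_line {t. 0 < t \<and> ennreal t < D}"
    unfolding distr_fun_eq using assms by (intro emeasure_mono emeasure_initial) auto
  then show ?thesis by (simp add: emeasure_initial)
qed

lemma distr_fun_geI:
  assumes "f \<in> borel_measurable half_line" "0 \<le> c"
    and "\<And>t. \<lbrakk>c < t; ennreal (t - c) < D\<rbrakk> \<Longrightarrow> \<tau> < \<bar>f t\<bar>"
  shows "D \<le> distr_fun f \<tau>"
proof -
  have "emeasure half_line {t. c < t \<and> ennreal (t - c) < D} \<le> distr_fun f \<tau>"
    unfolding distr_fun_eq using assms by (intro emeasure_mono sets_superlevel) auto
  then show ?thesis by (simp add: emeasure_shifted_initial assms)
qed

lemma distr_fun_mono: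
  assumes "g \<in> borel_measurable half_line" "AE t in half_line. \<bar>f t\<bar> \<le> \<bar>g t\<bar>"
  shows "distr_fun f \<tau> \<le> distr_fun g \<tau>"
  unfolding distr_fun_eq
proof (rule emeasure_mono_AE)
  show "AE s in half_line. s \<in> {s. 0 < s \<and> \<tau> < \<bar>f s\<bar>} \<longrightarrow> s \<in> {s. 0 < s \<and> \<tau> < \<bar>g s\<bar>}"
    using assms(2) by eventually_elim auto
qed (rule sets_superlevel[OF assms(1)])

lemma distr_fun_cong_AE:
  assumes "f \<in> borel_measurable half_line" "g \<in> borel_measurable half_line"
    and eq: "AE t in half_line. f t = g t"
  shows "distr_fun f \<tau> = distr_fun g \<tau>"
proof (rule antisym)
  have "AE t in half_line. \<bar>f t\<bar> \<le> \<bar>g t\<bar>" "AE t in half_line. \<bar>g t\<bar> \<le> \<bar>f t\<bar>"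
    using eq by (eventually_elim, simp)+
  then show "distr_fun f \<tau> \<le> distr_fun g \<tau>" "distr_fun g \<tau> \<le> distr_fun f \<tau>"
    using assms by (simp_all add: distr_fun_mono)
qed

lemma distr_fun_antimono:
  assumes "f \<in> borel_measurable half_line" "\<sigma> \<le> \<tau>"
  shows "distr_fun f \<tau> \<le> distr_fun f \<sigma>"
  unfolding distr_fun_eq using assms by (intro emeasure_mono sets_superlevel) auto

text \<open>
  Continuity of the measure from below along the sets \<open>{|f| > \<tau> + 1/(n+1)}\<close>, whose union is \<open>{|f| > \<tau>}\<close>.
\<close>

lemma distr_fun_right_continuous:
  assumes f: "f \<in> borel_measurable half_line" and t: "t < distr_fun f \<tau>"
  obtains \<tau>' where "\<tau> < \<tau>'" "t < distr_fun f \<tau>'"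
proof -
  define A where "A n = {s. 0 < s \<and> \<tau> + 1 / Suc n < \<bar>f s\<bar>}" for n
  have "{s. 0 < s \<and> \<tau> < \<bar>f s\<bar>} = (\<Union>n. A n)"
  proof (safe, goal_cases)
    case (1 s)
    then obtain n where "inverse (real (Suc n)) < \<bar>f s\<bar> - \<tau>"
      using reals_Archimedean[of "\<bar>f s\<bar> - \<tau>"] by auto
    then show ?case using 1 by (auto simp: A_def inverse_eq_divide intro!: exI[of _ n])
  next
    case (2 s n)
    then show ?case by (simp add: A_def)
  next
    case (3 s n)
    have "0 < 1 / real (Suc n)" by simp
    with 3 show ?case unfolding A_def by (smt (verit) mem_Collect_eq)
  qed
  moreover have "(SUP n. emeasure half_line (A n)) = emeasure half_line (\<Union>n. A n)"
  proof (rule SUP_emeasure_incseq)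
    show "range A \<subseteq> sets half_line"
      unfolding A_def using sets_superlevel[OF f] by blast
    show "incseq A"
    proof (rule incseq_SucI, rule subsetI)
      fix n x assume "x \<in> A n"
      moreover have "1 / real (Suc (Suc n)) \<le> 1 / real (Suc n)"
        by (simp add: frac_le)
      ultimately show "x \<in> A (Suc n)" unfolding A_def by auto
    qed
  qed
  ultimately have "t < (SUP n. emeasure half_line (A n))"
    using t by (simp add: distr_fun_eq)
  then obtain n where "t < emeasure half_line (A n)"
    by (auto simp: less_SUP_iff)
  then show ?thesis
    using that[of "\<tau> + 1 / Suc n"] by (simp add: A_def distr_fun_eq)
qed

section \<open>Dilations and truncated dilations\<close>

lemma measurable_dilation:
  assumes "f \<in> borel_measurable half_line" "c > 0"
  shows "dilation c f \<in> borel_measurable half_line"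
proof -
  have "(\<lambda>t. t / c) \<in> measurable lebesgue lebesgue"
    using lebesgue_measurable_scaling[of "1 / c", where 'a = real] by (simp add: mult.commute[of _ "inverse _"] divide_inverse cong: measurable_cong)
  then have "(\<lambda>t. t / c) \<in> measurable half_line half_line"
    using assms(2) by (intro measurable_restrict_space3) auto
  from measurable_compose[OF this assms(1)] show ?thesis
    by (simp add: dilation_def[abs_def])
qed

text \<open>
  The superlevel set of the dilated function is the superlevel set of \<open>f\<close> stretched by \<open>c\<close>.
\<close>

lemma distr_fun_dilation:
  assumes "c > 0"
  shows "distr_fun (dilation c f) \<tau> = ennreal c * distr_fun f \<tau>"
proof -
  have "{s. 0 < s \<and> \<tau> < \<bar>dilation c f s\<bar>} = (\<lambda>x. c *\<^sub>R x + 0) ` {s. 0 < s \<and> \<tau> < \<bar>f s\<bar>}"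
    (is "_ = ?R")
  proof safe
    fix s assume "0 < s" "\<tau> < \<bar>dilation c f s\<bar>"
    then show "s \<in> ?R"
      using assms by (intro image_eqI[of _ _ "s / c"]) (auto simp: dilation_def)
  qed (use assms in \<open>auto simp: dilation_def\<close>)
  then have "distr_fun (dilation c f) \<tau> = emeasure half_line ?R"
    by (simp add: distr_fun_eq)
  also have "\<dots> = emeasure lebesgue ?R"
    using assms by (intro emeasure_half_line) auto
  also have "\<dots> = ennreal c * emeasure lebesgue {s. 0 < s \<and> \<tau> < \<bar>f s\<bar>}"
    using emeasure_lebesgue_affine[of c 0 "{s. 0 < s \<and> \<tau> < \<bar>f s\<bar>}"] assms
    by (simp add: add.commute image_def)
  finally show ?thesis by (simp add: distr_fun_eq emeasure_half_line subset_eq)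
qed

lemma distr_fun_dilation_mono:
  assumes "distr_fun f \<tau> \<le> distr_fun g \<tau>" "0 < c"
  shows "distr_fun (dilation c f) \<tau> \<le> distr_fun (dilation c g) \<tau>"
  using assms by (simp add: distr_fun_dilation mult_left_mono)

lemma measurable_dilation0:
  assumes "f \<in> borel_measurable half_line" "0 < c"
  shows "dilation0 c f \<in> borel_measurable half_line"
proof -
  have ind: "indicator {0..1::real} \<in> borel_measurable half_line"
    by (intro measurable_restrict_space1 borel_measurable_indicator) simp
  have "(\<lambda>s. f s * indicator {0..1} s) \<in> borel_measurable half_line"
    by (intro borel_measurable_times assms ind)
  then have "dilation c (\<lambda>s. f s * indicator {0..1} s) \<in> borel_measurable half_line"
    using assms(2) by (rule measurable_dilation)
  then show ?thesis
    unfolding dilation0_def[abs_def] by (intro borel_measurable_times ind)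
qed

lemma ennreal_less_mult_iff:
  assumes "0 < c"
  shows "ennreal (t / c) < D \<longleftrightarrow> ennreal t < ennreal c * D"
proof (cases D)
  case (real r)
  then show ?thesis
    using assms by (cases "t < 0")
      (auto simp: ennreal_less_iff field_simps ennreal_neg zero_less_mult_iff simp flip: ennreal_mult)
qed (use assms in \<open>simp add: ennreal_mult_top\<close>)

section \<open>The decreasing rearrangement\<close>

text \<open>
  The real-valued counterpart of \<^const>\<open>rearrangement\<close>. It is used only at points where some level is
  admissible; at other points the infimum of the empty set carries no meaning.
\<close>

definition rearr :: "(real \<Rightarrow> real) \<Rightarrow> real \<Rightarrow> real" where
  "rearr f t = Inf {\<tau>. 0 \<le> \<tau> \<and> distr_fun f \<tau> \<le> ennreal t}"

lemma rearr_nonneg: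
  assumes "0 \<le> \<tau>" "distr_fun f \<tau> \<le> ennreal t"
  shows "0 \<le> rearr f t"
  unfolding rearr_def using assms by (intro cInf_greatest) auto

text \<open>
  The Galois connection between a function's rearrangement and its distribution function. It turns every
  comparison of rearrangements below into one of distribution functions; the direction from right to left is
  where right continuity enters.
\<close>

lemma less_rearr_iff:
  assumes f: "f \<in> borel_measurable half_line" and "0 \<le> \<sigma>" "distr_fun f \<sigma> \<le> ennreal t" and "0 \<le> \<tau>"
  shows "\<tau> < rearr f t \<longleftrightarrow> ennreal t < distr_fun f \<tau>"
proof
  assume *: "\<tau> < rearr f t"
  show "ennreal t < distr_fun f \<tau>"
  proof (rule ccontr)
    assume "\<not> ennreal t < distr_fun f \<tau>"
    then have "rearr f t \<le> \<tau>"
      unfolding rearr_def using \<open>0 \<le> \<tau>\<close> by (intro cInf_lower bdd_belowI[of _ 0]) auto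
    with * show False by simp
  qed
next
  assume "ennreal t < distr_fun f \<tau>"
  then obtain \<tau>' where \<tau>': "\<tau> < \<tau>'" "ennreal t < distr_fun f \<tau>'"
    by (rule distr_fun_right_continuous[OF f])
  have "\<tau>' \<le> rearr f t"
    unfolding rearr_def
  proof (rule cInf_greatest)
    show "{\<tau>. 0 \<le> \<tau> \<and> distr_fun f \<tau> \<le> ennreal t} \<noteq> {}" using assms(2,3) by blast
    fix y assume "y \<in> {\<tau>. 0 \<le> \<tau> \<and> distr_fun f \<tau> \<le> ennreal t}"
    then have "distr_fun f y < distr_fun f \<tau>'" using \<tau>' by auto
    then show "\<tau>' \<le> y" using distr_fun_antimono[OF f, of y \<tau>'] by (meson leD linear)
  qed
  with \<tau>' show "\<tau> < rearr f t" by simp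
qed

section \<open>Dyadic step functions\<close>

lemma mem_dyadic_iff: "t > 0 \<Longrightarrow> t \<in> dyadic k \<longleftrightarrow> \<lfloor>log 2 t\<rfloor> = k"
  using powr_real_of_int'[of 2 k] powr_real_of_int'[of 2 "k + 1"]
  by (simp add: dyadic_def floor_log_eq_powr_iff)

lemma dyadic_pos: "t \<in> dyadic k \<Longrightarrow> 0 < t"
  unfolding dyadic_def by (smt (verit) atLeastLessThan_iff zero_less_power_int)

lemma disjoint_dyadic: "disjoint_family dyadic"
  unfolding disjoint_family_on_def
proof (intro ballI impI equals0I)
  fix j k t assume "j \<noteq> k" "t \<in> dyadic j \<inter> dyadic k"
  then show False
    using dyadic_pos[of t j] mem_dyadic_iff[of t j] mem_dyadic_iff[of t k] by simp
qed

lemma dyadic_index: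
  assumes "0 < t"
  obtains k where "t \<in> dyadic k" "2 powi k \<le> t" "t < 2 * 2 powi k"
proof -
  have "t \<in> dyadic \<lfloor>log 2 t\<rfloor>" using assms by (simp add: mem_dyadic_iff)
  then show ?thesis using that[of "\<lfloor>log 2 t\<rfloor>"] by (simp add: dyadic_def power_int_add)
qed

lemma log_two_powi: "log 2 (2 powi n) = real_of_int n"
  by (simp flip: powr_real_of_int')

lemma floor_log_dilation: "0 < t \<Longrightarrow> \<lfloor>log 2 (t / 2 powi n)\<rfloor> = \<lfloor>log 2 t\<rfloor> - n"
  by (simp add: log_divide log_two_powi)

lemma floor_log_less_iff: "0 < t \<Longrightarrow> \<lfloor>log 2 t\<rfloor> < n \<longleftrightarrow> t < 2 powi n"
  by (simp add: floor_less_iff log_less_iff powr_real_of_int')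

lemma step_fun_eq: "step_fun a t = (if t > 0 then a \<lfloor>log 2 t\<rfloor> else 0)"
proof (cases "t > 0")
  case True
  have "((\<lambda>k. a k * indicator (dyadic k) t) has_sum a \<lfloor>log 2 t\<rfloor>) UNIV"
    using True by (intro has_sum_finite_neutralI[of "{\<lfloor>log 2 t\<rfloor>}"])
      (auto simp: indicator_def mem_dyadic_iff)
  then show ?thesis using True by (simp add: step_fun_def infsumI)
next
  case False
  then have "indicator (dyadic k) t = (0::real)" for k
    using dyadic_pos[of t k] by (auto simp: indicator_def)
  then show ?thesis using False by (simp add: step_fun_def)
qed

lemma step_fun_dyadic: "t \<in> dyadic k \<Longrightarrow> step_fun a t = a k"
  using dyadic_pos[of t k] mem_dyadic_iff[of t k] by (simp add: step_fun_eq)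

lemma step_fun_measurable: "step_fun a \<in> borel_measurable half_line"
proof -
  have "(\<lambda>t. a \<lfloor>log 2 t\<rfloor>) \<in> borel_measurable borel"
    by (rule measurable_compose[where N = "count_space UNIV"]) auto
  then have "(\<lambda>t. if t > 0 then a \<lfloor>log 2 t\<rfloor> else 0) \<in> borel_measurable borel"
    by measurable
  then have "step_fun a \<in> borel_measurable lebesgue"
    unfolding step_fun_eq[abs_def] by (intro measurable_completion) simp
  then show ?thesis by (rule measurable_restrict_space1)
qed

text \<open>
  Dilation by \<open>2\<^sup>n\<close> maps \<open>\<Delta>\<^sub>k\<close> onto \<open>\<Delta>\<^bsub>k+n\<^esub>\<close>.
\<close>

lemma step_fun_shift: "step_fun (shift n a) = dilation (2 powi n) (step_fun a)"
proof
  fix t :: real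
  have "\<lfloor>log 2 (t / 2 powi n)\<rfloor> = \<lfloor>log 2 t\<rfloor> - n" if "t > 0"
    using that by (simp add: log_divide log_two_powi)
  moreover have "0 < t / 2 powi n \<longleftrightarrow> 0 < t"
    using pos_less_divide_eq[of "2 powi n" 0 t] zero_less_power_int[of "2::real" n] by (simp only: mult_zero_left zero_less_numeral)
  ultimately show "step_fun (shift n a) t = dilation (2 powi n) (step_fun a) t"
    by (auto simp: step_fun_eq dilation_def shift_def simp del: zero_less_divide_iff)
qed

text \<open>
  Truncation to \<open>k < 0\<close> corresponds to \<open>(0,1)\<close>, whereas the dilation is truncated to the closed interval, so
  the two sides may differ at \<open>t = 1\<close> and at \<open>t = 2\<^sup>n\<close>.
\<close>

lemma step_fun_trunc_shift_neg_AE: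
  "AE t in half_line. dilation0 (2 powi n) (step_fun a) t = step_fun (trunc_shift {..<0} n a) t"
  using AE_half_line_neq[of 1] AE_half_line_neq[of "2 powi n"] AE_space
proof eventually_elim
  case (elim t)
  define k where "k = \<lfloor>log 2 t\<rfloor>"
  have pos: "0 < t" "(0::real) < 2 powi n" using elim by auto
  have "k < 0 \<longleftrightarrow> t < 1"
    using pos floor_log_less_iff[of t 0] by (simp add: k_def)
  moreover have "k - n < 0 \<longleftrightarrow> t < 2 powi n"
    using pos floor_log_less_iff[of t n] by (simp add: k_def)
  moreover have "step_fun a (t / 2 powi n) = a (k - n)"
    using pos by (simp add: step_fun_eq floor_log_dilation k_def)
  moreover have "step_fun b t = b k" for b
    using pos by (simp add: step_fun_eq k_def)
  ultimately show ?case
    using elim pos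
    by (auto simp: dilation0_def dilation_def trunc_shift_def shift_def indicator_def)
qed

text \<open>
  Used with \<open>r = 1\<close> for the full dyadic intervals and with \<open>r = 1/2\<close> for their halves; the integral is
  the sum of the lengths \<open>2\<^sup>k\<close> over \<open>k \<in> I\<close>.
\<close>

lemma emeasure_UN_dyadic_parts:
  assumes "\<And>k. B k \<in> sets lebesgue" "\<And>k. B k \<subseteq> dyadic k"
    and "\<And>k. emeasure lebesgue (B k) = ennreal (r * 2 powi k)" and "r \<ge> 0"
  shows "emeasure half_line (\<Union>k\<in>I. B k) =
    ennreal r * (\<integral>\<^sup>+k. ennreal (2 powi k) \<partial>count_space I)"
proof -
  have "disjoint_family B"
    using disjoint_dyadic assms(2) unfolding disjoint_family_on_def by blast
  have sub: "B k \<subseteq> {0<..}" for k using assms(2) dyadic_pos by blast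
  have "emeasure half_line (\<Union>k\<in>I. B k) = (\<integral>\<^sup>+k. emeasure half_line (B k) \<partial>count_space I)"
    using assms(1) sub \<open>disjoint_family B\<close>
    by (intro emeasure_UN_countable) (auto simp: disjoint_family_on_def sets_half_line_iff)
  also have "\<dots> = (\<integral>\<^sup>+k. ennreal r * ennreal (2 powi k) \<partial>count_space I)"
    using assms sub by (simp add: emeasure_half_line ennreal_mult)
  also have "\<dots> = ennreal r * (\<integral>\<^sup>+k. ennreal (2 powi k) \<partial>count_space I)"
    by (rule nn_integral_cmult) auto
  finally show ?thesis .
qed

lemma distr_fun_step_fun_part:
  assumes "\<And>k. B k \<in> sets lebesgue" "\<And>k. B k \<subseteq> dyadic k"
    and "\<And>k. emeasure lebesgue (B k) = ennreal (r * 2 powi k)" and "r \<ge> 0" and "0 \<le> \<tau>"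
  shows "distr_fun (\<lambda>t. step_fun a t * indicator (\<Union>k. B k) t) \<tau> =
    ennreal r * (\<integral>\<^sup>+k. ennreal (2 powi k) \<partial>count_space {k. \<tau> < \<bar>a k\<bar>})"
proof -
  have "{s. 0 < s \<and> \<tau> < \<bar>step_fun a s * indicator (\<Union>k. B k) s\<bar>} = (\<Union>k\<in>{k. \<tau> < \<bar>a k\<bar>}. B k)"
  proof (intro equalityI subsetI)
    fix s assume "s \<in> {s. 0 < s \<and> \<tau> < \<bar>step_fun a s * indicator (\<Union>k. B k) s\<bar>}"
    with \<open>0 \<le> \<tau>\<close> obtain k where "s \<in> B k" "\<tau> < \<bar>step_fun a s\<bar>"
      by (cases "s \<in> (\<Union>k. B k)") auto
    moreover from this have "step_fun a s = a k" using assms(2) step_fun_dyadic by blast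
    ultimately show "s \<in> (\<Union>k\<in>{k. \<tau> < \<bar>a k\<bar>}. B k)" by auto
  next
    fix s assume "s \<in> (\<Union>k\<in>{k. \<tau> < \<bar>a k\<bar>}. B k)"
    then obtain k where "\<tau> < \<bar>a k\<bar>" "s \<in> B k" by blast
    moreover from this have "s \<in> dyadic k" using assms(2) by blast
    ultimately show "s \<in> {s. 0 < s \<and> \<tau> < \<bar>step_fun a s * indicator (\<Union>k. B k) s\<bar>}"
      using dyadic_pos[of s k] step_fun_dyadic[of s k a] by (auto simp: indicator_def)
  qed
  then show ?thesis
    unfolding distr_fun_eq using emeasure_UN_dyadic_parts[OF assms(1-4)] by simp
qed

lemma distr_fun_step_fun:
  assumes "0 \<le> \<tau>"
  shows "distr_fun (step_fun a) \<tau> = (\<integral>\<^sup>+k. ennreal (2 powi k) \<partial>count_space {k. \<tau> < \<bar>a k\<bar>})"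
proof -
  have "distr_fun (step_fun a) \<tau> = distr_fun (\<lambda>t. step_fun a t * indicator (\<Union>k. dyadic k) t) \<tau>"
    unfolding distr_fun_eq
    by (intro arg_cong[where f = "emeasure half_line"] Collect_cong conj_cong refl)
      (auto simp: indicator_def mem_dyadic_iff)
  also have "\<dots> = ennreal 1 * (\<integral>\<^sup>+k. ennreal (2 powi k) \<partial>count_space {k. \<tau> < \<bar>a k\<bar>})"
    using assms by (intro distr_fun_step_fun_part) (auto simp: dyadic_def power_int_add)
  finally show ?thesis by simp
qed

lemma measure_dyadic_le_distr_fun:
  assumes "\<tau> < \<bar>a k\<bar>"
  shows "ennreal (2 powi k) \<le> distr_fun (step_fun a) \<tau>"
proof -
  have "ennreal (2 powi k) = emeasure half_line (dyadic k)"
    using dyadic_pos[of _ k] by (subst emeasure_half_line) (auto simp: dyadic_def power_int_add)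
  also have "\<dots> \<le> distr_fun (step_fun a) \<tau>"
    unfolding distr_fun_eq using assms dyadic_pos[of _ k]
    by (intro emeasure_mono sets_superlevel step_fun_measurable) (auto simp: step_fun_dyadic)
  finally show ?thesis .
qed

section \<open>Rearrangement invariant norms and distribution functions\<close>

context ri_space
begin

text \<open>
  At every \<open>t\<close>, a level admissible for \<open>f\<close> is admissible for \<open>g\<close>, so the infimum that defines \<open>g\<^sup>*(t)\<close> is
  taken over a larger set.
\<close>

lemma distr_fun_le_imp:
  assumes "f \<in> X" "g \<in> borel_measurable half_line"
    and le: "\<And>\<tau>. 0 \<le> \<tau> \<Longrightarrow> distr_fun g \<tau> \<le> distr_fun f \<tau>"
  shows "g \<in> X" "nrm g \<le> nrm f"
proof -
  have "rearrangement g t \<le> rearrangement f t" for t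
    unfolding rearrangement_def distr_fun_def[symmetric]
    using le by (intro INF_superset_mono) (auto intro: order_trans)
  then show "g \<in> X" "nrm g \<le> nrm f"
    using rearrangement_invariant assms by blast+
qed

lemma nrm_neq_0_mono:
  assumes "f \<in> X" "g \<in> X" "\<And>\<tau>. 0 \<le> \<tau> \<Longrightarrow> distr_fun f \<tau> \<le> distr_fun g \<tau>" "nrm f \<noteq> 0"
  shows "nrm g \<noteq> 0"
  using distr_fun_le_imp(2)[OF assms(2) measurable[OF assms(1)] assms(3)] nrm_nonneg[OF assms(1)]
    assms(4) by simp

lemma nrm_eq_0_iff_distr_fun:
  assumes "f \<in> X"
  shows "nrm f = 0 \<longleftrightarrow> distr_fun f 0 = 0"
proof -
  have "(AE t in half_line. f t = 0) \<longleftrightarrow> distr_fun f 0 = 0"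
    unfolding distr_fun_eq
    by (intro AE_iff_measurable sets_superlevel measurable assms) auto
  then show ?thesis using assms by (simp add: nrm_eq_0_iff)
qed

lemma nrm_cong_AE:
  assumes "f \<in> X" "g \<in> borel_measurable half_line" "AE t in half_line. f t = g t"
  shows "g \<in> X" "nrm g = nrm f"
proof -
  have le: "AE t in half_line. \<bar>g t\<bar> \<le> \<bar>f t\<bar>" "AE t in half_line. \<bar>f t\<bar> \<le> \<bar>g t\<bar>"
    using assms(3) by (eventually_elim, simp)+
  then show "g \<in> X" using ideal[OF assms(1,2)] by blast
  then show "nrm g = nrm f"
    using ideal[OF assms(1,2) le(1)] ideal[OF \<open>g \<in> X\<close> measurable[OF assms(1)] le(2)] by simp
qed

text \<open>
  If every level were exceeded on a set of measure more than \<open>t\<close>, then \<open>x\<close> would dominate, in the sense of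
  distribution functions, all multiples of the indicator of \<open>(0,t)\<close>. That indicator would then have norm 0
  without vanishing almost everywhere. So rearrangements of elements of \<open>X\<close> are finite at positive arguments.
\<close>

lemma distr_fun_eventually_small:
  assumes x: "x \<in> X" and "0 < t"
  obtains \<tau> where "0 \<le> \<tau>" "distr_fun x \<tau> \<le> ennreal t"
proof (rule ccontr)
  assume "\<not> thesis"
  with that have large: "ennreal t < distr_fun x \<tau>" if "0 \<le> \<tau>" for \<tau>
    using \<open>0 \<le> \<tau>\<close> by (meson not_le)
  define g :: "real \<Rightarrow> real" where "g = indicator {0<..<t}"
  have meas: "(\<lambda>s. c * g s) \<in> borel_measurable half_line" for c
    unfolding g_def by (intro borel_measurable_times borel_measurable_indicator) (auto simp: sets_half_line_iff)
  have bound: "(\<lambda>s. c * g s) \<in> X \<and> nrm (\<lambda>s. c * g s) \<le> nrm x" for c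
  proof -
    have "distr_fun (\<lambda>s. c * g s) \<tau> \<le> distr_fun x \<tau>" if "0 \<le> \<tau>" for \<tau>
    proof -
      have "distr_fun (\<lambda>s. c * g s) \<tau> \<le> ennreal t"
        using that by (intro distr_fun_leI) (auto simp: g_def ennreal_less_iff indicator_def of_bool_def split: if_splits)
      with large[OF that] show ?thesis by simp
    qed
    with distr_fun_le_imp[OF x meas] show ?thesis by blast
  qed
  then have "g \<in> X" using bound[of 1] by simp
  have "nrm g = 0"
  proof (rule ccontr)
    assume "nrm g \<noteq> 0"
    then have pos: "nrm g > 0" using nrm_nonneg[OF \<open>g \<in> X\<close>] by simp
    \<comment> \<open>The multiple of the indicator whose norm would be \<open>nrm x + 1\<close>.\<close>
    define c where "c = (nrm x + 1) / nrm g"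
    have "0 \<le> c" using pos nrm_nonneg[OF x] by (simp add: c_def)
    then have "c * nrm g \<le> nrm x"
      using bound[of c] nrm_scale[OF \<open>g \<in> X\<close>, of c] by simp
    then show False using pos by (simp add: c_def)
  qed
  then have "distr_fun g 0 = 0" using \<open>g \<in> X\<close> by (simp add: nrm_eq_0_iff_distr_fun)
  moreover have "ennreal t \<le> distr_fun g 0"
    using meas[of 1] by (intro distr_fun_geI[where c = 0]) (auto simp: g_def ennreal_less_iff)
  ultimately show False using \<open>0 < t\<close> by simp
qed

lemma less_rearr_iff_mem:
  assumes "x \<in> X" "0 < t" "0 \<le> \<tau>"
  shows "\<tau> < rearr x t \<longleftrightarrow> ennreal t < distr_fun x \<tau>"
proof -
  obtain \<sigma> where "0 \<le> \<sigma>" "distr_fun x \<sigma> \<le> ennreal t"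
    using distr_fun_eventually_small assms by blast
  then show ?thesis using assms measurable by (intro less_rearr_iff)
qed

lemma rearr_nonneg_mem: "\<lbrakk>x \<in> X; 0 < t\<rbrakk> \<Longrightarrow> 0 \<le> rearr x t"
  by (meson distr_fun_eventually_small rearr_nonneg)

end

section \<open>Approximation by dyadic step functions\<close>

context ri_space
begin

text \<open>
  Cut every dyadic interval at its midpoint. The restrictions of \<open>Sa\<close> to the left halves and to the right
  halves are both equimeasurable with \<open>S(\<tau>\<^bsub>-1\<^esub>a)\<close>, which is \<open>Sa\<close> compressed by the factor 2, and the
  triangle inequality applies to their sum.
\<close>

lemma step_fun_double:
  assumes "step_fun (shift (-1) a) \<in> X"
  shows "step_fun a \<in> X" "nrm (step_fun a) \<le> 2 * nrm (step_fun (shift (-1) a))"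
proof -
  define L where "L k = {2 powi k ..< 3/2 * 2 powi k :: real}" for k :: int
  define R where "R k = {3/2 * 2 powi k ..< 2 powi (k+1) :: real}" for k :: int
  have pos: "(0::real) < 2 powi k" for k by simp
  have sub: "L k \<subseteq> dyadic k" "R k \<subseteq> dyadic k" for k
  proof -
    have "3/2 * 2 powi k \<le> (2 * 2 powi k :: real)" "2 powi k \<le> (3/2 * 2 powi k :: real)"
      using pos[of k] by linarith+
    then show "L k \<subseteq> dyadic k" "R k \<subseteq> dyadic k"
      by (auto simp: L_def R_def dyadic_def power_int_add)
  qed
  have half: "(\<lambda>t. step_fun a t * indicator (\<Union>k. B k) t) \<in> X \<and>
      nrm (\<lambda>t. step_fun a t * indicator (\<Union>k. B k) t) \<le> nrm (step_fun (shift (-1) a))"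
    if B: "\<And>k. B k \<in> sets lebesgue" "\<And>k. B k \<subseteq> dyadic k"
      "\<And>k. emeasure lebesgue (B k) = ennreal (1/2 * 2 powi k)" for B
  proof -
    have "indicator (\<Union>k. B k) \<in> borel_measurable lebesgue"
      using B(1) by (intro borel_measurable_indicator sets.countable_UN) auto
    then have "indicator (\<Union>k. B k) \<in> borel_measurable half_line"
      by (rule measurable_restrict_space1)
    then have "(\<lambda>t. step_fun a t * indicator (\<Union>k. B k) t) \<in> borel_measurable half_line"
      by (intro borel_measurable_times step_fun_measurable)
    moreover have "distr_fun (\<lambda>t. step_fun a t * indicator (\<Union>k. B k) t) \<tau>
        = distr_fun (step_fun (shift (-1) a)) \<tau>" if "0 \<le> \<tau>" for \<tau>
      using that by (subst distr_fun_step_fun_part[OF B])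
        (simp_all add: step_fun_shift distr_fun_dilation distr_fun_step_fun power_int_minus)
    ultimately show ?thesis
      using distr_fun_le_imp[OF assms] by simp
  qed
  have L: "(\<lambda>t. step_fun a t * indicator (\<Union>k. L k) t) \<in> X \<and>
      nrm (\<lambda>t. step_fun a t * indicator (\<Union>k. L k) t) \<le> nrm (step_fun (shift (-1) a))"
    by (rule half[OF _ sub(1)]) (simp_all add: L_def)
  have R: "(\<lambda>t. step_fun a t * indicator (\<Union>k. R k) t) \<in> X \<and>
      nrm (\<lambda>t. step_fun a t * indicator (\<Union>k. R k) t) \<le> nrm (step_fun (shift (-1) a))"
    by (rule half[OF _ sub(2)]) (simp_all add: R_def power_int_add)
  have "step_fun a t = step_fun a t * indicator (\<Union>k. L k) t + step_fun a t * indicator (\<Union>k. R k) t" for t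
  proof (cases "0 < t")
    case True
    then obtain k where k: "t \<in> dyadic k" by (rule dyadic_index)
    have uniq: "j = k" if "t \<in> dyadic j" for j
      using that k True by (simp add: mem_dyadic_iff)
    have "t \<in> (\<Union>k. L k) \<longleftrightarrow> t \<in> L k" "t \<in> (\<Union>k. R k) \<longleftrightarrow> t \<in> R k"
      using uniq sub by blast+
    moreover have "t \<in> L k \<longleftrightarrow> t \<notin> R k"
      using k by (auto simp: L_def R_def dyadic_def)
    ultimately show ?thesis by (auto simp: indicator_def)
  qed (simp add: step_fun_eq)
  then have eq: "step_fun a = (\<lambda>t. step_fun a t * indicator (\<Union>k. L k) t + step_fun a t * indicator (\<Union>k. R k) t)"
    by blast
  show "step_fun a \<in> X" by (subst eq) (use L R add in blast)
  have "nrm (step_fun a) \<le> nrm (\<lambda>t. step_fun a t * indicator (\<Union>k. L k) t)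
      + nrm (\<lambda>t. step_fun a t * indicator (\<Union>k. R k) t)"
    by (subst eq) (use L R nrm_triangle in blast)
  then show "nrm (step_fun a) \<le> 2 * nrm (step_fun (shift (-1) a))" using L R by simp
qed

text \<open>
  Each application of \<open>\<tau>\<^bsub>-1\<^esub>\<close> removes one factor 2 from the distribution function, and undoing it costs
  one factor 2 in the norm.
\<close>

lemma step_fun_norm_le_power:
  assumes "x \<in> X" "\<And>\<tau>. 0 \<le> \<tau> \<Longrightarrow> distr_fun (step_fun a) \<tau> \<le> 2 ^ j * distr_fun x \<tau>"
  shows "step_fun a \<in> X \<and> nrm (step_fun a) \<le> 2 ^ j * nrm x"
  using assms(2)
proof (induction j arbitrary: a)
  case 0
  then show ?case using distr_fun_le_imp[OF assms(1) step_fun_measurable, of a] by simp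
next
  case (Suc j)
  have "distr_fun (step_fun (shift (-1) a)) \<tau> \<le> 2 ^ j * distr_fun x \<tau>" if "0 \<le> \<tau>" for \<tau>
  proof -
    have "distr_fun (step_fun (shift (-1) a)) \<tau> = ennreal (1/2) * distr_fun (step_fun a) \<tau>"
      by (simp add: step_fun_shift distr_fun_dilation power_int_minus)
    also have "\<dots> \<le> ennreal (1/2) * (2 ^ Suc j * distr_fun x \<tau>)"
      using Suc.prems[OF that] by (intro mult_left_mono) auto
    also have "\<dots> = (ennreal (1/2) * 2) * (2 ^ j * distr_fun x \<tau>)"
      by (simp add: ac_simps)
    also have "ennreal (1/2) * 2 = 1"
      using ennreal_mult[of "1/2" 2] by simp
    finally show ?thesis by simp
  qed
  from Suc.IH[OF this] step_fun_double[of a] show ?case by fastforce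
qed

text \<open>
  With \<open>D = d\<^sub>x(\<tau>)\<close>, the set \<open>{Sa > \<tau>}\<close> is the union of the \<open>\<Delta>\<^sub>k\<close> with \<open>2\<^sup>k < D\<close>. It contains
  \<open>(0,D)\<close> because \<open>t \<in> \<Delta>\<^sub>k\<close> implies \<open>2\<^sup>k \<le> t\<close>, and it lies in \<open>(0,2D)\<close> because \<open>t \<in> \<Delta>\<^sub>k\<close> implies \<open>t < 2\<^bsup>k+1\<^esup>\<close>.
\<close>

lemma step_fun_rearr:
  fixes x defines "a \<equiv> \<lambda>k. rearr x (2 powi k)"
  assumes x: "x \<in> X" and "0 \<le> \<tau>"
  shows "distr_fun x \<tau> \<le> distr_fun (step_fun a) \<tau>"
    and "distr_fun (step_fun a) \<tau> \<le> 2 * distr_fun x \<tau>"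
proof -
  have iff: "\<tau> < \<bar>a k\<bar> \<longleftrightarrow> ennreal (2 powi k) < distr_fun x \<tau>" for k
    using less_rearr_iff_mem[OF x _ \<open>0 \<le> \<tau>\<close>, of "2 powi k"] rearr_nonneg_mem[OF x, of "2 powi k"]
    by (simp add: a_def)
  show "distr_fun x \<tau> \<le> distr_fun (step_fun a) \<tau>"
  proof (rule distr_fun_geI[where c = 0])
    fix t :: real assume "0 < t" "ennreal (t - 0) < distr_fun x \<tau>"
    then obtain k where "t \<in> dyadic k" "2 powi k \<le> t" by (metis dyadic_index)
    moreover from this have "ennreal (2 powi k) \<le> ennreal t" by (intro ennreal_leI)
    ultimately show "\<tau> < \<bar>step_fun a t\<bar>"
      using \<open>ennreal (t - 0) < distr_fun x \<tau>\<close> by (simp add: step_fun_dyadic iff)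
  qed (auto intro: step_fun_measurable)
  show "distr_fun (step_fun a) \<tau> \<le> 2 * distr_fun x \<tau>"
  proof (rule distr_fun_leI)
    fix t :: real assume "0 < t" and less: "\<tau> < \<bar>step_fun a t\<bar>"
    then obtain k where k: "t \<in> dyadic k" "t < 2 * 2 powi k" by (metis dyadic_index)
    then have "ennreal (t / 2) \<le> ennreal (2 powi k)" by (intro ennreal_leI) simp
    also have "\<dots> < distr_fun x \<tau>" using less k(1) by (simp add: step_fun_dyadic iff)
    finally show "ennreal t < 2 * distr_fun x \<tau>"
      by (simp add: ennreal_less_mult_iff)
  qed
qed

lemma shift_minus_one_norm:
  assumes "step_fun a \<in> X"
  shows "step_fun (shift (-1) a) \<in> X" "nrm (step_fun (shift (-1) a)) \<le> nrm (step_fun a)"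
proof -
  have "distr_fun (step_fun (shift (-1) a)) \<tau> \<le> distr_fun (step_fun a) \<tau>" for \<tau>
  proof -
    have "ennreal (2 powi (-1)) * distr_fun (step_fun a) \<tau> \<le> ennreal 1 * distr_fun (step_fun a) \<tau>"
      by (intro mult_right_mono ennreal_leI) (auto simp: power_int_minus)
    then show ?thesis by (simp add: step_fun_shift distr_fun_dilation)
  qed
  then show "step_fun (shift (-1) a) \<in> X" "nrm (step_fun (shift (-1) a)) \<le> nrm (step_fun a)"
    using distr_fun_le_imp[OF assms step_fun_measurable] by blast+
qed

lemma mem_seq_space: "a \<in> seq_space X \<longleftrightarrow> step_fun a \<in> X"
  by (simp add: seq_space_def)

lemma seq_norm_nonneg: "a \<in> seq_space X \<Longrightarrow> 0 \<le> seq_norm nrm a"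
  by (simp add: seq_norm_def mem_seq_space nrm_nonneg)

lemma step_fun_rearr_norm:
  assumes "x \<in> X"
  shows "(\<lambda>k. rearr x (2 powi k)) \<in> seq_space X"
    and "seq_norm nrm (\<lambda>k. rearr x (2 powi k)) \<le> 2 * nrm x"
    and "nrm x \<noteq> 0 \<Longrightarrow> seq_norm nrm (\<lambda>k. rearr x (2 powi k)) \<noteq> 0"
  using step_fun_norm_le_power[OF assms, of _ 1] step_fun_rearr[OF assms]
    nrm_neq_0_mono[OF assms, of "step_fun (\<lambda>k. rearr x (2 powi k))"]
  by (auto simp: mem_seq_space seq_norm_def)

end

section \<open>Dilations and shifts\<close>

text \<open>
  The scheme of all comparisons of operator norms below: to each \<open>f\<close> that competes on the left corresponds a
  competitor \<open>f'\<close> on the right whose norm is at most \<open>p\<close> times as large and whose image is at least \<open>1/q\<close> times as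
  large. Functions that \<open>T\<close> annihilates need no partner.
\<close>

lemma op_norm_on_le:
  fixes p q :: real
  assumes "0 < p" "0 < q" and D: "\<And>f. f \<in> D \<Longrightarrow> 0 \<le> N f" "\<And>f. f \<in> D' \<Longrightarrow> 0 \<le> N' f"
    and X': "\<And>f. f \<in> X' \<Longrightarrow> 0 \<le> N' f"
    and transfer: "\<And>f. \<lbrakk>f \<in> D; N f \<noteq> 0\<rbrakk> \<Longrightarrow> T f \<in> X \<and> N (T f) = 0 \<or>
      (\<exists>f'\<in>D'. N' f' \<noteq> 0 \<and> N' f' \<le> p * N f \<and> (T' f' \<in> X' \<longrightarrow> T f \<in> X \<and> N (T f) \<le> q * N' (T' f')))"
  shows "op_norm_on X N D T \<le> ennreal (p * q) * op_norm_on X' N' D' T'"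
proof -
  define u' where "u' f = (if T' f \<in> X' then ennreal (N' (T' f) / N' f) else \<infinity>)" for f
  have "(if T f \<in> X then ennreal (N (T f) / N f) else \<infinity>) \<le> ennreal (p * q) * op_norm_on X' N' D' T'"
    if f: "f \<in> D" "N f \<noteq> 0" for f
    using transfer[OF f]
  proof (elim disjE bexE conjE)
    assume "T f \<in> X" "N (T f) = 0"
    then show ?thesis by simp
  next
    fix f' assume f': "f' \<in> D'" "N' f' \<noteq> 0" "N' f' \<le> p * N f"
      and T: "T' f' \<in> X' \<longrightarrow> T f \<in> X \<and> N (T f) \<le> q * N' (T' f')"
    have pos: "0 < N f" "0 < N' f'" using D f f' by (simp_all add: order_less_le)
    have "(if T f \<in> X then ennreal (N (T f) / N f) else \<infinity>) \<le> ennreal (p * q) * u' f'"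
    proof (cases "T' f' \<in> X'")
      case True
      have "N (T f) * N' f' \<le> (q * N' (T' f')) * (p * N f)"
        using True T X'[OF True] pos f' \<open>0 < q\<close> by (intro mult_mono) auto
      then have "N (T f) / N f \<le> p * q * (N' (T' f') / N' f')"
        using pos by (simp add: field_simps)
      then show ?thesis
        using True T X'[OF True] pos assms(1,2)
        by (simp add: u'_def flip: ennreal_mult)
    next
      case False
      then show ?thesis using assms(1,2) by (simp add: u'_def ennreal_mult_top)
    qed
    also have "\<dots> \<le> ennreal (p * q) * op_norm_on X' N' D' T'"
      unfolding op_norm_on_def u'_def[symmetric] using f' by (intro mult_left_mono SUP_upper) auto
    finally show ?thesis .
  qed
  then show ?thesis
    unfolding op_norm_on_def[of X N D T] by (intro SUP_least) blast
qed

context ri_space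
begin

lemma shift_norm_le_dil_norm:
  "shift_norm (seq_space X) (seq_norm nrm) n \<le> dil_norm X nrm n"
proof -
  have "op_norm_on (seq_space X) (seq_norm nrm) (seq_space X) (shift n)
      \<le> ennreal (1 * 1) * op_norm_on X nrm X (dilation (2 powi n))"
  proof (rule op_norm_on_le)
    fix a assume "a \<in> seq_space X" "seq_norm nrm a \<noteq> 0"
    then show "shift n a \<in> seq_space X \<and> seq_norm nrm (shift n a) = 0 \<or>
      (\<exists>f\<in>X. nrm f \<noteq> 0 \<and> nrm f \<le> 1 * seq_norm nrm a \<and> (dilation (2 powi n) f \<in> X \<longrightarrow>
        shift n a \<in> seq_space X \<and> seq_norm nrm (shift n a) \<le> 1 * nrm (dilation (2 powi n) f)))"
      by (intro disjI2 bexI[of _ "step_fun a"]) (simp_all add: seq_norm_def mem_seq_space step_fun_shift)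
  qed (auto simp: seq_norm_nonneg nrm_nonneg)
  then show ?thesis by (simp add: shift_norm_def dil_norm_def)
qed

lemma dil_norm_le_shift_norm:
  "dil_norm X nrm n \<le> 2 * shift_norm (seq_space X) (seq_norm nrm) n"
proof -
  have "op_norm_on X nrm X (dilation (2 powi n))
      \<le> ennreal (2 * 1) * op_norm_on (seq_space X) (seq_norm nrm) (seq_space X) (shift n)"
  proof (rule op_norm_on_le)
    fix x assume x: "x \<in> X" "nrm x \<noteq> 0"
    define a where "a = (\<lambda>k. rearr x (2 powi k))"
    have "dilation (2 powi n) x \<in> X \<and> nrm (dilation (2 powi n) x) \<le> seq_norm nrm (shift n a)"
      if "shift n a \<in> seq_space X"
    proof -
      have "distr_fun (dilation (2 powi n) x) \<tau> \<le> distr_fun (step_fun (shift n a)) \<tau>" if "0 \<le> \<tau>" for \<tau>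
        unfolding step_fun_shift a_def using x that
        by (intro distr_fun_dilation_mono step_fun_rearr) auto
      then show ?thesis
        using distr_fun_le_imp[of "step_fun (shift n a)"] that x
        by (auto simp: mem_seq_space seq_norm_def measurable_dilation measurable)
    qed
    then show "dilation (2 powi n) x \<in> X \<and> nrm (dilation (2 powi n) x) = 0 \<or>
      (\<exists>a\<in>seq_space X. seq_norm nrm a \<noteq> 0 \<and> seq_norm nrm a \<le> 2 * nrm x \<and>
        (shift n a \<in> seq_space X \<longrightarrow> dilation (2 powi n) x \<in> X \<and>
          nrm (dilation (2 powi n) x) \<le> 1 * seq_norm nrm (shift n a)))"
      using step_fun_rearr_norm[OF x(1)] x(2)
      by (intro disjI2 bexI[of _ a]) (simp_all add: a_def)
  qed (auto simp: seq_norm_nonneg nrm_nonneg)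
  then show ?thesis by (simp add: shift_norm_def dil_norm_def)
qed

end

section \<open>Dilations and shifts near zero\<close>

context ri_space
begin

lemma shift_neg_norm_le_dil0_norm:
  "shift_neg_norm (seq_space X) (seq_norm nrm) n \<le> dil0_norm X nrm n"
proof -
  have "op_norm_on (seq_space X) (seq_norm nrm) (seq_space X) (trunc_shift {..<0} n)
      \<le> ennreal (1 * 1) * op_norm_on X nrm X (dilation0 (2 powi n))"
  proof (rule op_norm_on_le)
    fix a assume a: "a \<in> seq_space X" "seq_norm nrm a \<noteq> 0"
    have "trunc_shift {..<0} n a \<in> seq_space X \<and>
        seq_norm nrm (trunc_shift {..<0} n a) = nrm (dilation0 (2 powi n) (step_fun a))"
      if "dilation0 (2 powi n) (step_fun a) \<in> X"
      using nrm_cong_AE[OF that step_fun_measurable step_fun_trunc_shift_neg_AE]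
      by (simp add: mem_seq_space seq_norm_def)
    then show "trunc_shift {..<0} n a \<in> seq_space X \<and> seq_norm nrm (trunc_shift {..<0} n a) = 0 \<or>
      (\<exists>f\<in>X. nrm f \<noteq> 0 \<and> nrm f \<le> 1 * seq_norm nrm a \<and> (dilation0 (2 powi n) f \<in> X \<longrightarrow>
        trunc_shift {..<0} n a \<in> seq_space X \<and>
        seq_norm nrm (trunc_shift {..<0} n a) \<le> 1 * nrm (dilation0 (2 powi n) f)))"
      using a by (intro disjI2 bexI[of _ "step_fun a"]) (simp_all add: seq_norm_def mem_seq_space)
  qed (auto simp: seq_norm_nonneg nrm_nonneg)
  then show ?thesis by (simp add: trunc_shift_norm_def dil0_norm_def)
qed

text \<open>
  The truncations to \<open>k \<le> 0\<close> and to \<open>k < 0\<close> are conjugate under \<open>\<tau>\<^bsub>-1\<^esub>\<close>. Moving a sequence by \<open>\<tau>\<^bsub>-1\<^esub>\<close> does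
  not increase its norm, and moving the image back at most doubles it.
\<close>

lemma shift0_norm_le_dil0_norm:
  "shift0_norm (seq_space X) (seq_norm nrm) n \<le> 2 * dil0_norm X nrm n"
proof -
  have "op_norm_on (seq_space X) (seq_norm nrm) (seq_space X) (trunc_shift {..0} n)
      \<le> ennreal (1 * 2) * op_norm_on X nrm X (dilation0 (2 powi n))"
  proof (rule op_norm_on_le)
    fix a assume "a \<in> seq_space X" and nz: "seq_norm nrm a \<noteq> 0"
    then have a: "step_fun a \<in> X" by (simp add: mem_seq_space)
    note b = shift_minus_one_norm[OF a]
    have comm: "trunc_shift {..<0} n (shift (-1) a) = shift (-1) (trunc_shift {..0} n a)"
      by (auto simp: trunc_shift_def shift_def indicator_def fun_eq_iff algebra_simps)
    have "nrm (step_fun (shift (-1) a)) \<noteq> 0"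
      using step_fun_double(2)[OF b(1)] nz nrm_nonneg[OF a] by (auto simp: seq_norm_def)
    moreover have "trunc_shift {..0} n a \<in> seq_space X \<and>
        seq_norm nrm (trunc_shift {..0} n a) \<le> 2 * nrm (dilation0 (2 powi n) (step_fun (shift (-1) a)))"
      if "dilation0 (2 powi n) (step_fun (shift (-1) a)) \<in> X"
      using nrm_cong_AE[OF that step_fun_measurable step_fun_trunc_shift_neg_AE]
        step_fun_double[of "trunc_shift {..0} n a"]
      by (simp add: mem_seq_space seq_norm_def comm)
    ultimately show "trunc_shift {..0} n a \<in> seq_space X \<and> seq_norm nrm (trunc_shift {..0} n a) = 0 \<or>
      (\<exists>f\<in>X. nrm f \<noteq> 0 \<and> nrm f \<le> 1 * seq_norm nrm a \<and> (dilation0 (2 powi n) f \<in> X \<longrightarrow>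
        trunc_shift {..0} n a \<in> seq_space X \<and>
        seq_norm nrm (trunc_shift {..0} n a) \<le> 2 * nrm (dilation0 (2 powi n) f)))"
      using b by (intro disjI2 bexI[of _ "step_fun (shift (-1) a)"]) (simp_all add: seq_norm_def)
  qed (auto simp: seq_norm_nonneg nrm_nonneg)
  then show ?thesis by (simp add: trunc_shift_norm_def dil0_norm_def)
qed

text \<open>
  Both distribution functions are compared with the minimum of \<open>1\<close>, \<open>2\<^sup>n\<close> and \<open>2\<^sup>n d\<^sub>x(\<tau>)\<close>: the
  two truncations confine the dilated function to \<open>(0, min 1 2\<^sup>n]\<close>, and the step function exceeds \<open>\<tau>\<close> on the
  whole initial interval of that length. Any index set that contains the negative integers works, which covers the
  truncations to \<open>k < 0\<close> and to \<open>k \<le> 0\<close> together.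
\<close>

lemma distr_fun_dilation0_le:
  fixes n
  assumes x: "x \<in> X" and "{..<0} \<subseteq> A" "0 \<le> \<tau>"
  shows "distr_fun (dilation0 (2 powi n) x) \<tau>
    \<le> distr_fun (step_fun (trunc_shift A n (\<lambda>k. rearr x (2 powi k)))) \<tau>"
proof -
  define T :: real where "T = 2 powi n"
  have T: "0 < T" by (simp add: T_def)
  define D where "D = min (ennreal (min 1 T)) (ennreal T * distr_fun x \<tau>)"
  have "distr_fun (dilation0 T x) \<tau> \<le> emeasure half_line {0<..min 1 T}"
    unfolding distr_fun_eq using \<open>0 \<le> \<tau>\<close> T
    by (intro emeasure_mono)
      (auto simp: dilation0_def dilation_def sets_half_line_iff indicator_def split: if_splits)
  also have "\<dots> = ennreal (min 1 T)" using T by (simp add: emeasure_half_line subset_eq)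
  moreover have "distr_fun (dilation0 T x) \<tau> \<le> ennreal T * distr_fun x \<tau>"
    unfolding distr_fun_dilation[OF T, symmetric] using x T
    by (intro distr_fun_mono measurable_dilation measurable)
      (auto simp: dilation0_def dilation_def indicator_def)
  ultimately have "distr_fun (dilation0 T x) \<tau> \<le> D" by (simp add: D_def)
  also have "D \<le> distr_fun (step_fun (trunc_shift A n (\<lambda>k. rearr x (2 powi k)))) \<tau>"
  proof (rule distr_fun_geI[where c = 0])
    fix t :: real assume t: "0 < t" and D: "ennreal (t - 0) < D"
    then have "t < 1" "t < T" using T by (auto simp: D_def ennreal_less_iff)
    have less: "ennreal (t / T) < distr_fun x \<tau>"
      using D T by (simp add: D_def ennreal_less_mult_iff)
    obtain k where k: "t \<in> dyadic k" using t by (metis dyadic_index)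
    then have fl: "\<lfloor>log 2 t\<rfloor> = k" using t by (simp add: mem_dyadic_iff)
    have "t / T \<in> dyadic (k - n)"
      using t T fl floor_log_dilation[OF t, of n] by (simp add: mem_dyadic_iff T_def)
    then have "2 powi (k - n) \<le> t / T" by (simp add: dyadic_def)
    with less have "\<tau> < rearr x (2 powi (k - n))"
      using less_rearr_iff_mem[OF x, of "2 powi (k - n)" \<tau>] \<open>0 \<le> \<tau>\<close>
      by (auto intro: le_less_trans ennreal_leI)
    moreover have "k < 0" using fl t \<open>t < 1\<close> floor_log_less_iff[of t 0] by simp
    moreover have "k - n < 0"
      using fl t \<open>t < T\<close> floor_log_less_iff[of t n] by (simp add: T_def)
    ultimately have "\<tau> < rearr x (2 powi (k - n))" "k \<in> A" "k - n \<in> A"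
      using \<open>{..<0} \<subseteq> A\<close> by auto
    then show "\<tau> < \<bar>step_fun (trunc_shift A n (\<lambda>k. rearr x (2 powi k))) t\<bar>"
      using k by (simp add: step_fun_dyadic trunc_shift_def shift_def)
  qed (simp_all add: step_fun_measurable)
  finally show ?thesis by (simp add: T_def)
qed

lemma dil0_norm_le_trunc_shift_norm:
  assumes "{..<0} \<subseteq> A"
  shows "dil0_norm X nrm n \<le> 2 * trunc_shift_norm A (seq_space X) (seq_norm nrm) n"
proof -
  have "op_norm_on X nrm X (dilation0 (2 powi n))
      \<le> ennreal (2 * 1) * op_norm_on (seq_space X) (seq_norm nrm) (seq_space X) (trunc_shift A n)"
  proof (rule op_norm_on_le)
    fix x assume x: "x \<in> X" "nrm x \<noteq> 0"
    define a where "a = (\<lambda>k. rearr x (2 powi k))"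
    have "dilation0 (2 powi n) x \<in> X \<and> nrm (dilation0 (2 powi n) x) \<le> seq_norm nrm (trunc_shift A n a)"
      if "trunc_shift A n a \<in> seq_space X"
      using distr_fun_le_imp[of "step_fun (trunc_shift A n a)" "dilation0 (2 powi n) x"]
        distr_fun_dilation0_le[OF x(1) assms] that x
      by (auto simp: mem_seq_space seq_norm_def measurable_dilation0 measurable a_def)
    then show "dilation0 (2 powi n) x \<in> X \<and> nrm (dilation0 (2 powi n) x) = 0 \<or>
      (\<exists>a\<in>seq_space X. seq_norm nrm a \<noteq> 0 \<and> seq_norm nrm a \<le> 2 * nrm x \<and>
        (trunc_shift A n a \<in> seq_space X \<longrightarrow> dilation0 (2 powi n) x \<in> X \<and>
          nrm (dilation0 (2 powi n) x) \<le> 1 * seq_norm nrm (trunc_shift A n a)))"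
      using step_fun_rearr_norm[OF x(1)] x(2)
      by (intro disjI2 bexI[of _ a]) (simp_all add: a_def)
  qed (auto simp: seq_norm_nonneg nrm_nonneg)
  then show ?thesis by (simp add: trunc_shift_norm_def dil0_norm_def)
qed

end

section \<open>Dilations and shifts near infinity\<close>

context ri_space
begin

text \<open>
  Below the level \<open>c\<close> the function exceeds \<open>\<tau>\<close> on all of \<open>[1,2]\<close>, from the level \<open>c\<close> on it does so
  almost nowhere.
\<close>

lemma distr_fun_G_set:
  assumes "z \<in> G_set X" "0 \<le> \<tau>"
  shows "distr_fun z \<tau> = 0 \<or> 1 \<le> distr_fun z \<tau>"
proof -
  obtain c g where c: "c > 0" and g: "g \<in> borel_measurable half_line"
      "\<And>t. t \<notin> {2<..} \<Longrightarrow> g t = 0" "\<And>t. \<bar>g t\<bar> \<le> c"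
      and z: "z \<in> X" "AE t in half_line. z t = c * indicator {1..2} t + g t"
    using assms(1) by (auto simp: G_set_def)
  define h where "h t = c * indicator {1..2} t + g t" for t
  have "indicator {1..2::real} \<in> borel_measurable half_line"
    by (intro measurable_restrict_space1 borel_measurable_indicator) simp
  then have h: "h \<in> borel_measurable half_line"
    unfolding h_def[abs_def] using g(1) by (intro borel_measurable_add borel_measurable_times) auto
  have eq: "distr_fun z \<tau> = distr_fun h \<tau>"
    using z(2) by (intro distr_fun_cong_AE measurable z(1) h) (simp add: h_def)
  show ?thesis
  proof (cases "\<tau> < c")
    case True
    have "\<tau> < \<bar>h t\<bar>" if "1 < t" "ennreal (t - 1) < 1" for t
    proof -
      have "t < 2" using that by (simp add: ennreal_less_iff flip: ennreal_1)
      then have "h t = c" using that g(2)[of t] by (simp add: h_def)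
      then show ?thesis using True c by simp
    qed
    then have "1 \<le> distr_fun h \<tau>" by (intro distr_fun_geI[where c = 1] h) auto
    then show ?thesis by (simp add: eq)
  next
    case False
    have "\<bar>h t\<bar> \<le> \<tau>" for t
      using g(2)[of t] g(3)[of t] False c by (cases "t > 2") (auto simp: h_def indicator_def)
    then have "distr_fun h \<tau> \<le> 0"
      by (intro distr_fun_leI) (meson not_le)
    then show ?thesis by (simp add: eq)
  qed
qed

text \<open>
  The index shift by one doubles the intervals on which \<open>Sb\<close> is large; dropping \<open>k < 0\<close> then removes at most
  measure 1. With \<open>D = d\<^sub>z(\<tau>) \<ge> 1\<close> enough remains, since \<open>2D - 1 \<ge> D\<close>. The upper bound loses one factor 2
  from the shift and one from the dyadic sampling.
\<close>

lemma step_fun_rearr_nonneg_part: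
  fixes z defines "b \<equiv> \<lambda>k::int. if 0 \<le> k then rearr z (2 powi (k - 1)) else 0"
  assumes z: "z \<in> X" and gap: "distr_fun z \<tau> = 0 \<or> 1 \<le> distr_fun z \<tau>" and "0 \<le> \<tau>"
  shows "distr_fun z \<tau> \<le> distr_fun (step_fun b) \<tau>"
    and "distr_fun (step_fun b) \<tau> \<le> 4 * distr_fun z \<tau>"
proof -
  have iff: "\<tau> < \<bar>b k\<bar> \<longleftrightarrow> 0 \<le> k \<and> ennreal (2 powi (k - 1)) < distr_fun z \<tau>" for k
    using less_rearr_iff_mem[OF z _ \<open>0 \<le> \<tau>\<close>, of "2 powi (k - 1)"] rearr_nonneg_mem[OF z, of "2 powi (k - 1)"]
      \<open>0 \<le> \<tau>\<close> by (simp add: b_def)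
  show "distr_fun z \<tau> \<le> distr_fun (step_fun b) \<tau>"
  proof (cases "distr_fun z \<tau> = 0")
    case False
    then have ge1: "1 \<le> distr_fun z \<tau>" using gap by simp
    show ?thesis
    proof (rule distr_fun_geI[where c = 1])
      fix t :: real assume t: "1 < t" "ennreal (t - 1) < distr_fun z \<tau>"
      then have half: "ennreal (t / 2) < distr_fun z \<tau>"
      proof (cases "t < 2")
        case True
        then have "ennreal (t / 2) < ennreal 1" using t by (intro ennreal_lessI) auto
        also have "ennreal 1 \<le> distr_fun z \<tau>" using ge1 by simp
        finally show ?thesis .
      next
        case False
        then have "ennreal (t / 2) \<le> ennreal (t - 1)" by (intro ennreal_leI) simp
        then show ?thesis using t(2) by (rule le_less_trans)
      qed
      obtain k where k: "t \<in> dyadic k" "2 powi k \<le> t" using t(1) by (metis dyadic_index less_trans zero_less_one)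
      have "ennreal (2 powi (k - 1)) \<le> ennreal (t / 2)"
        using k(2) by (intro ennreal_leI) (simp add: power_int_diff)
      moreover have "0 \<le> k"
        using k(1) t(1) floor_log_less_iff[of t 0] by (simp add: mem_dyadic_iff not_less[symmetric])
      ultimately show "\<tau> < \<bar>step_fun b t\<bar>" using half k(1) by (simp add: step_fun_dyadic iff)
    qed (auto intro: step_fun_measurable)
  qed simp
  show "distr_fun (step_fun b) \<tau> \<le> 4 * distr_fun z \<tau>"
  proof (rule distr_fun_leI)
    fix t :: real assume "0 < t" and less: "\<tau> < \<bar>step_fun b t\<bar>"
    then obtain k where k: "t \<in> dyadic k" "t < 2 * 2 powi k" by (metis dyadic_index)
    then have "ennreal (t / 4) \<le> ennreal (2 powi (k - 1))"
      by (intro ennreal_leI) (simp add: power_int_diff)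
    also have "\<dots> < distr_fun z \<tau>" using less k(1) by (simp add: step_fun_dyadic iff)
    finally show "ennreal t < 4 * distr_fun z \<tau>"
      by (simp add: ennreal_less_mult_iff)
  qed
qed

lemma dilation_inf_dom_subset: "dilation_inf_dom X n \<subseteq> X"
  by (auto simp: dilation_inf_dom_def G_set_def)

text \<open>
  For \<open>n > 0\<close> it is \<open>x\<close> itself that has the gap in its distribution function, for \<open>n \<le> 0\<close> it is its image
  under the dilation. So the sequence is built from \<open>x\<close> in the first case, and in the second case from the
  image and then shifted back by \<open>-n\<close>. Either way it is supported where the truncations leave it
  unchanged.
\<close>

lemma dil_inf_norm_le_shift_inf_norm:
  "dil_inf_norm X nrm n \<le> 4 * shift_inf_norm (seq_space X) (seq_norm nrm) n"
proof -
  define T :: real where "T = 2 powi n"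
  have T: "0 < T" by (simp add: T_def)
  have "op_norm_on X nrm (dilation_inf_dom X n) (dilation T)
      \<le> ennreal (4 * 1) * op_norm_on (seq_space X) (seq_norm nrm) (seq_space X) (trunc_shift {0..} n)"
  proof (rule op_norm_on_le)
    fix x assume dom: "x \<in> dilation_inf_dom X n" and nz: "nrm x \<noteq> 0"
    have x: "x \<in> X" using dom dilation_inf_dom_subset by blast
    obtain a where a: "\<And>\<tau>. 0 \<le> \<tau> \<Longrightarrow> distr_fun x \<tau> \<le> distr_fun (step_fun a) \<tau>"
        "\<And>\<tau>. 0 \<le> \<tau> \<Longrightarrow> distr_fun (step_fun a) \<tau> \<le> 4 * distr_fun x \<tau>"
        "step_fun (trunc_shift {0..} n a) = dilation T (step_fun a)"
    proof (cases "n \<le> 0")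
      case False
      then have G: "x \<in> G_set X" using dom by (simp add: dilation_inf_dom_def)
      define b where "b = (\<lambda>k::int. if 0 \<le> k then rearr x (2 powi (k - 1)) else 0)"
      have "trunc_shift {0..} n b = shift n b"
        using False by (auto simp: trunc_shift_def shift_def b_def indicator_def fun_eq_iff)
      then show ?thesis
        using that[of b] step_fun_rearr_nonneg_part[OF x distr_fun_G_set[OF G]]
        by (simp add: b_def step_fun_shift T_def)
    next
      case True
      then have G: "dilation T x \<in> G_set X" using dom by (simp add: dilation_inf_dom_def T_def)
      define b where "b = (\<lambda>k::int. if 0 \<le> k then rearr (dilation T x) (2 powi (k - 1)) else 0)"
      have "dilation T x \<in> X" using G by (simp add: G_set_def)
      note b = step_fun_rearr_nonneg_part[OF this distr_fun_G_set[OF G], folded b_def]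
      have T': "ennreal (inverse T) * ennreal T = 1" using T by (simp flip: ennreal_mult)
      have scale: "ennreal (inverse T) * (ennreal T * u) = u" for u
        using T' by (simp flip: mult.assoc)
      have distr: "distr_fun (step_fun (shift (-n) b)) \<tau> = ennreal (inverse T) * distr_fun (step_fun b) \<tau>" for \<tau>
        by (simp add: step_fun_shift distr_fun_dilation power_int_minus T_def)
      have "trunc_shift {0..} n (shift (-n) b) = b"
        using True by (auto simp: trunc_shift_def shift_def b_def indicator_def fun_eq_iff)
      moreover have "shift n (shift (-n) b) = b" by (simp add: shift_def fun_eq_iff)
      ultimately have eq: "step_fun (trunc_shift {0..} n (shift (-n) b)) = dilation T (step_fun (shift (-n) b))"
        unfolding T_def by (simp flip: step_fun_shift)
      show ?thesis
      proof (rule that[OF _ _ eq])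
        fix \<tau> :: real assume \<tau>: "0 \<le> \<tau>"
        have "ennreal (inverse T) * distr_fun (dilation T x) \<tau> \<le> ennreal (inverse T) * distr_fun (step_fun b) \<tau>"
          by (intro mult_left_mono b \<tau>) auto
        then show "distr_fun x \<tau> \<le> distr_fun (step_fun (shift (-n) b)) \<tau>"
          using T by (simp add: distr distr_fun_dilation scale)
        have "ennreal (inverse T) * distr_fun (step_fun b) \<tau> \<le> ennreal (inverse T) * (4 * distr_fun (dilation T x) \<tau>)"
          by (intro mult_left_mono b \<tau>) auto
        then show "distr_fun (step_fun (shift (-n) b)) \<tau> \<le> 4 * distr_fun x \<tau>"
          using T by (simp add: distr distr_fun_dilation scale mult.left_commute[of _ 4])
      qed
    qed
    have E: "a \<in> seq_space X" "seq_norm nrm a \<le> 4 * nrm x" "seq_norm nrm a \<noteq> 0"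
      using step_fun_norm_le_power[OF x, of a 2] nrm_neq_0_mono[OF x _ a(1) nz] a(2)
      by (auto simp: mem_seq_space seq_norm_def)
    have "dilation T x \<in> X \<and> nrm (dilation T x) \<le> seq_norm nrm (trunc_shift {0..} n a)"
      if "trunc_shift {0..} n a \<in> seq_space X"
    proof -
      have "distr_fun (dilation T x) \<tau> \<le> distr_fun (step_fun (trunc_shift {0..} n a)) \<tau>" if "0 \<le> \<tau>" for \<tau>
        unfolding a(3) using a(1)[OF that] T by (rule distr_fun_dilation_mono)
      then show ?thesis
        using distr_fun_le_imp[of "step_fun (trunc_shift {0..} n a)"] that x T
        by (auto simp: mem_seq_space seq_norm_def measurable_dilation measurable)
    qed
    then show "dilation T x \<in> X \<and> nrm (dilation T x) = 0 \<or>
      (\<exists>a\<in>seq_space X. seq_norm nrm a \<noteq> 0 \<and> seq_norm nrm a \<le> 4 * nrm x \<and>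
        (trunc_shift {0..} n a \<in> seq_space X \<longrightarrow> dilation T x \<in> X \<and>
          nrm (dilation T x) \<le> 1 * seq_norm nrm (trunc_shift {0..} n a)))"
      using E by (intro disjI2 bexI[of _ a]) simp_all
  qed (auto simp: seq_norm_nonneg nrm_nonneg subsetD[OF dilation_inf_dom_subset])
  then show ?thesis by (simp add: trunc_shift_norm_def dil_inf_norm_def T_def)
qed

text \<open>
  The function \<open>t \<mapsto> w\<^sup>*(t - 1)\<close> on \<open>(1,\<infinity>)\<close>. For \<open>0 \<le> s < 1\<close> the value \<open>w\<^sup>*(s)\<close> exceeds \<open>\<tau>\<close> exactly if
  \<open>d\<^sub>w(\<tau>) > s\<close>, which by the gap means \<open>d\<^sub>w(\<tau>) > 0\<close>; hence \<open>w\<^sup>*\<close> equals \<open>c = w\<^sup>*(0)\<close> on \<open>[0,1)\<close>. The gap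
  also makes \<open>w\<^sup>*(0)\<close> finite.
\<close>

lemma equimeasurable_G_set:
  assumes w: "w \<in> X" and nz: "distr_fun w 0 \<noteq> 0"
    and gap: "\<And>\<tau>. 0 \<le> \<tau> \<Longrightarrow> distr_fun w \<tau> = 0 \<or> 1 \<le> distr_fun w \<tau>"
  obtains g where "g \<in> G_set X" "\<And>\<tau>. 0 \<le> \<tau> \<Longrightarrow> distr_fun g \<tau> = distr_fun w \<tau>"
proof -
  \<comment> \<open>By the gap, a level exceeded on measure at most \<open>1/2\<close> is exceeded almost nowhere.\<close>
  obtain \<sigma> where \<sigma>: "0 \<le> \<sigma>" "distr_fun w \<sigma> \<le> ennreal (1/2)"
    using distr_fun_eventually_small[OF w, of "1/2"] by auto
  have "ennreal (1/2) < ennreal 1" by (intro ennreal_lessI) auto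
  then have "ennreal (1/2) < 1" by (simp only: ennreal_1)
  then have \<sigma>0: "distr_fun w \<sigma> = 0" using gap[OF \<sigma>(1)] \<sigma>(2) by auto
  have iff: "\<tau> < rearr w t \<longleftrightarrow> ennreal t < distr_fun w \<tau>" if "0 \<le> \<tau>" for t \<tau>
    using less_rearr_iff[OF measurable[OF w] \<sigma>(1) _ that, of t] \<sigma>0 by simp
  have nonneg: "0 \<le> rearr w t" for t using rearr_nonneg[OF \<sigma>(1), of w t] \<sigma>0 by simp
  define c where "c = rearr w 0"
  have "0 < c" using iff[of 0 0] nz by (simp add: c_def zero_less_iff_neq_zero)
  have le_c: "rearr w t \<le> c" for t
  proof (rule ccontr)
    assume "\<not> rearr w t \<le> c"
    then have "0 < distr_fun w c" using iff[of c t] nonneg[of 0] by (auto simp: c_def intro: le_less_trans)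
    then show False using iff[of c 0] nonneg[of 0] by (simp add: c_def)
  qed
  have eq_c: "rearr w t = c" if "t < 1" for t
  proof (rule ccontr)
    assume "rearr w t \<noteq> c"
    then have "rearr w t < c" using le_c[of t] by simp
    then have "1 \<le> distr_fun w (rearr w t)"
      using iff[OF nonneg[of t], of 0] gap[OF nonneg[of t]] by (auto simp: c_def)
    moreover have "ennreal t < 1" using ennreal_lessI[OF zero_less_one that] by simp
    ultimately have "ennreal t < distr_fun w (rearr w t)" by (rule less_le_trans[rotated])
    then show False using iff[OF nonneg[of t], of t] by simp
  qed
  define g where "g t = (if 1 < t then rearr w (t - 1) else 0)" for t
  have level: "{t. 0 < t \<and> a < g t} = {t. 1 < t \<and> ennreal (t - 1) < distr_fun w a}" if "0 \<le> a" for a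
    using iff[OF that] that by (auto simp: g_def)
  have meas: "g \<in> borel_measurable half_line"
    unfolding borel_measurable_iff_greater
  proof
    fix a
    show "{t \<in> space half_line. a < g t} \<in> sets half_line"
    proof (cases "0 \<le> a")
      case True
      then show ?thesis using level emeasure_shifted_initial(2)[of 1 "distr_fun w a"] by simp
    next
      case False
      then have "{t \<in> space half_line. a < g t} = space half_line"
        using nonneg by (auto simp: g_def not_le intro: less_le_trans)
      then show ?thesis by (simp only: sets.top)
    qed
  qed
  have distr: "distr_fun g \<tau> = distr_fun w \<tau>" if "0 \<le> \<tau>" for \<tau>
  proof -
    have "\<bar>g t\<bar> = g t" for t using nonneg by (simp add: g_def)
    then show ?thesis
      by (simp add: distr_fun_eq[of g] level[OF that] emeasure_shifted_initial)
  qed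
  have gX: "g \<in> X" using distr_fun_le_imp(1)[OF w meas] distr by simp
  \<comment> \<open>At \<open>t = 1\<close> and \<open>t = 2\<close> the decomposition may fail, which the almost-everywhere equality permits.\<close>
  define h where "h t = g t * indicator {2<..} t" for t
  have "g \<in> G_set X"
    unfolding G_set_def
  proof (intro CollectI conjI exI)
    show "g \<in> X" "0 < c" by fact+
    have "indicator {2<..} \<in> borel_measurable half_line"
      by (intro measurable_restrict_space1 borel_measurable_indicator) simp
    then show "h \<in> borel_measurable half_line"
      unfolding h_def[abs_def] by (intro borel_measurable_times meas)
    show "\<forall>t. t \<notin> {2<..} \<longrightarrow> h t = 0" by (simp add: h_def)
    show "\<forall>t. \<bar>h t\<bar> \<le> c"
      using nonneg le_c \<open>0 < c\<close> by (simp add: h_def g_def indicator_def)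
    show "AE t in half_line. g t = c * indicator {1..2} t + h t"
      using AE_half_line_neq[of 1] AE_half_line_neq[of 2]
      by eventually_elim (auto simp: g_def h_def indicator_def eq_c)
  qed
  with distr show ?thesis by (rule that[rotated])
qed

text \<open>
  The two truncations keep the part \<open>y\<close> of \<open>Sa\<close> that is supported on \<open>[max 1 2\<^bsup>-n\<^esup>, \<infinity>)\<close>. A step function
  supported on \<open>k \<ge> 0\<close> has the gap required above, since each of its intervals has length at least 1. Thus \<open>y\<close>
  (for \<open>n > 0\<close>) or its dilation (for \<open>n \<le> 0\<close>) can be replaced by an equimeasurable function in
  \<^const>\<open>G_set\<close>.
\<close>

lemma shift_inf_norm_le_dil_inf_norm:
  "shift_inf_norm (seq_space X) (seq_norm nrm) n \<le> dil_inf_norm X nrm n"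
proof -
  define T :: real where "T = 2 powi n"
  have T: "0 < T" by (simp add: T_def)
  have "op_norm_on (seq_space X) (seq_norm nrm) (seq_space X) (trunc_shift {0..} n)
      \<le> ennreal (1 * 1) * op_norm_on X nrm (dilation_inf_dom X n) (dilation T)"
  proof (rule op_norm_on_le)
    fix a assume "a \<in> seq_space X"
    then have a: "step_fun a \<in> X" by (simp add: mem_seq_space)
    define b where "b = (\<lambda>k. if 0 \<le> k \<and> 0 \<le> k + n then a k else 0)"
    define y where "y = step_fun b"
    have Ty: "step_fun (trunc_shift {0..} n a) = dilation T y"
    proof -
      have "trunc_shift {0..} n a = shift n b"
        by (auto simp: trunc_shift_def shift_def b_def indicator_def fun_eq_iff)
      then show ?thesis by (simp add: step_fun_shift y_def T_def)
    qed
    have "AE t in half_line. \<bar>y t\<bar> \<le> \<bar>step_fun a t\<bar>"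
      by (intro AE_I2) (simp add: y_def b_def step_fun_eq)
    then have y: "y \<in> X" "nrm y \<le> nrm (step_fun a)"
      using ideal[OF a] step_fun_measurable unfolding y_def by blast+
    have meas_Ty: "dilation T y \<in> borel_measurable half_line"
      using measurable_dilation[OF measurable[OF y(1)] T] .
    show "trunc_shift {0..} n a \<in> seq_space X \<and> seq_norm nrm (trunc_shift {0..} n a) = 0 \<or>
      (\<exists>f\<in>dilation_inf_dom X n. nrm f \<noteq> 0 \<and> nrm f \<le> 1 * seq_norm nrm a \<and> (dilation T f \<in> X \<longrightarrow>
        trunc_shift {0..} n a \<in> seq_space X \<and>
        seq_norm nrm (trunc_shift {0..} n a) \<le> 1 * nrm (dilation T f)))"
    proof (cases "nrm y = 0")
      case True
      have "distr_fun (dilation T y) \<tau> \<le> distr_fun y \<tau>" if "0 \<le> \<tau>" for \<tau>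
      proof -
        have "distr_fun y \<tau> \<le> distr_fun y 0" using measurable[OF y(1)] that by (rule distr_fun_antimono)
        then have "distr_fun y \<tau> = 0" using True y(1) by (simp add: nrm_eq_0_iff_distr_fun)
        then show ?thesis using T by (simp add: distr_fun_dilation)
      qed
      from distr_fun_le_imp[OF y(1) meas_Ty this] True nrm_nonneg[of "dilation T y"]
      show ?thesis by (simp add: mem_seq_space seq_norm_def Ty)
    next
      case False
      define v where "v = (if n \<le> 0 then shift n b else b)"
      have v0: "v k = 0" if "k < 0" for k using that by (auto simp: v_def b_def shift_def)
      \<comment> \<open>The membership condition concerns the dilation of \<open>f\<close> by \<open>S\<close>, so \<open>f\<close> is obtained by
        replacing the dilation of \<open>y\<close> by \<open>S\<close> and then undoing the dilation.\<close>
      define S where "S = (if n \<le> 0 then T else 1)"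
      have S: "0 < S" "S \<le> 1"
        using T power_int_increasing[of n 0 "2::real"] by (auto simp: S_def T_def)
      have distr_v: "distr_fun (step_fun v) \<tau> = ennreal S * distr_fun y \<tau>" for \<tau>
        using T by (simp add: v_def S_def step_fun_shift y_def distr_fun_dilation T_def)
      have "distr_fun (step_fun v) \<tau> \<le> distr_fun y \<tau>" for \<tau>
        using mult_right_mono[of "ennreal S" 1 "distr_fun y \<tau>"] S by (simp add: distr_v)
      then have vX: "step_fun v \<in> X" using distr_fun_le_imp(1)[OF y(1) step_fun_measurable] by blast
      have v_nz: "distr_fun (step_fun v) 0 \<noteq> 0"
        using False S y(1) by (simp add: distr_v nrm_eq_0_iff_distr_fun)
      have gap: "distr_fun (step_fun v) \<tau> = 0 \<or> 1 \<le> distr_fun (step_fun v) \<tau>" if \<tau>: "0 \<le> \<tau>" for \<tau>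
      proof (cases "\<exists>k. \<tau> < \<bar>v k\<bar>")
        case True
        then obtain k where k: "\<tau> < \<bar>v k\<bar>" by blast
        then have "0 \<le> k" using v0[of k] \<tau> by (cases "k < 0") auto
        have "1 \<le> ennreal (2 powi k)" using \<open>0 \<le> k\<close> by (simp add: one_le_power_int)
        also have "\<dots> \<le> distr_fun (step_fun v) \<tau>" using k by (rule measure_dyadic_le_distr_fun)
        finally show ?thesis by simp
      next
        case False
        then have "distr_fun (step_fun v) \<tau> \<le> 0"
          using \<tau> by (intro distr_fun_leI) (auto simp: step_fun_eq)
        then show ?thesis by simp
      qed
      obtain g where g: "g \<in> G_set X" "\<And>\<tau>. 0 \<le> \<tau> \<Longrightarrow> distr_fun g \<tau> = ennreal S * distr_fun y \<tau>"
        using equimeasurable_G_set[OF vX v_nz gap] by (auto simp: distr_v)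
      define f where "f = dilation (inverse S) g"
      have gX: "g \<in> X" using g(1) by (simp add: G_set_def)
      have fmeas: "f \<in> borel_measurable half_line"
        unfolding f_def using S by (intro measurable_dilation measurable gX) simp
      have "ennreal (inverse S) * ennreal S = 1" using S by (simp flip: ennreal_mult)
      then have distr_f: "distr_fun f \<tau> = distr_fun y \<tau>" if "0 \<le> \<tau>" for \<tau>
        using that S by (simp add: f_def distr_fun_dilation g(2) flip: mult.assoc)
      have f: "f \<in> X" "nrm f \<le> nrm y" using distr_fun_le_imp[OF y(1) fmeas] distr_f by simp_all
      have "nrm f \<noteq> 0" using nrm_neq_0_mono[OF y(1) f(1) _ False] distr_f by simp
      moreover have "f \<in> dilation_inf_dom X n"
      proof -
        have "dilation S f = g" using S by (simp add: f_def dilation_def fun_eq_iff)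
        moreover have "f = g" if "S = 1" using that by (simp add: f_def dilation_def fun_eq_iff)
        ultimately show ?thesis using f(1) g(1) by (auto simp: dilation_inf_dom_def S_def T_def)
      qed
      moreover have "dilation T y \<in> X \<and> nrm (dilation T y) \<le> nrm (dilation T f)" if "dilation T f \<in> X"
        using distr_fun_le_imp[OF that meas_Ty] distr_f T by (simp add: distr_fun_dilation)
      ultimately show ?thesis
        using f y by (intro disjI2 bexI[of _ f]) (simp_all add: seq_norm_def mem_seq_space Ty)
    qed
  qed (auto simp: seq_norm_nonneg nrm_nonneg subsetD[OF dilation_inf_dom_subset])
  then show ?thesis by (simp add: trunc_shift_norm_def dil_inf_norm_def T_def)
qed

end

section \<open>Existence and comparison of exponents\<close>

text \<open>
  Fekete's lemma. Writing \<open>n = qm + r\<close> with \<open>r < m\<close> bounds \<open>u n\<close> by \<open>q u m + u r\<close>, so that \<open>u n / n\<close> is at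
  most \<open>u m / m + K / n\<close>, where \<open>m\<close> is chosen with \<open>u m / m\<close> close to the infimum.
\<close>

lemma subadditive_ratio_convergent:
  fixes u :: "nat \<Rightarrow> real"
  assumes sub: "\<And>m n. u (m + n) \<le> u m + u n" and lower: "\<And>n. - (C * real n) \<le> u n"
  shows "convergent (\<lambda>n. u n / real n)"
proof -
  define L where "L = (INF n\<in>{1..}. u n / real n)"
  have "bdd_below ((\<lambda>n. u n / real n) ` {1..})"
    using lower by (intro bdd_belowI2[of _ "- C"]) (simp add: field_simps)
  then have L_le: "L \<le> u n / real n" if "1 \<le> n" for n
    unfolding L_def using that by (intro cINF_lower) auto
  have "(\<lambda>n. u n / real n) \<longlonglongrightarrow> L"
  proof (rule LIMSEQ_I)
    fix e :: real assume "0 < e"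
    obtain m where m: "1 \<le> m" "u m / real m < L + e / 2"
    proof (rule ccontr)
      assume "\<not> thesis"
      with that have "L + e / 2 \<le> u m / real m" if "1 \<le> m" for m
        using \<open>1 \<le> m\<close> by (meson not_le)
      then have "L + e / 2 \<le> (INF n\<in>{1..}. u n / real n)" by (intro cINF_greatest) auto
      then have "L + e / 2 \<le> L" by (simp add: L_def)
      then show False using \<open>0 < e\<close> by simp
    qed
    \<comment> \<open>\<open>M\<close> bounds the remainder terms \<open>u r\<close> with \<open>r < m\<close>.\<close>
    define M where "M = (\<Sum>r<m. \<bar>u r\<bar>)"
    define K where "K = \<bar>u m\<bar> + M"
    have multiple: "u (q * m + r) \<le> real q * u m + u r" for q r
    proof (induction q)
      case (Suc q)
      have "u (Suc q * m + r) \<le> u m + u (q * m + r)"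
        using sub[of m "q * m + r"] by (simp add: add.assoc)
      with Suc show ?case by (simp add: algebra_simps)
    qed simp
    have upper: "u n / real n \<le> u m / real m + K / real n" if "1 \<le> n" for n
    proof -
      define q r where "q = n div m" and "r = n mod m"
      have n: "n = q * m + r" "r < m" using m by (simp_all add: q_def r_def)
      have "\<bar>u r\<bar> \<le> M" unfolding M_def using n(2) by (intro member_le_sum) auto
      moreover have "real q * u m = real n * (u m / real m) - real r * (u m / real m)"
        using m by (simp add: n(1) field_simps)
      moreover have "- (real r * (u m / real m)) \<le> \<bar>u m\<bar>"
      proof -
        have "\<bar>real r * (u m / real m)\<bar> = real r / real m * \<bar>u m\<bar>" by (simp add: abs_mult)
        also have "\<dots> \<le> 1 * \<bar>u m\<bar>" using n(2) by (intro mult_right_mono) auto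
        finally show ?thesis using abs_le_D2[of "real r * (u m / real m)" "\<bar>u m\<bar>"] by (simp only: mult_1)
      qed
      ultimately have "u n \<le> real n * (u m / real m) + K"
        using multiple[of q r] by (simp add: n(1)[symmetric] K_def)
      then have "u n / real n \<le> (real n * (u m / real m) + K) / real n"
        by (intro divide_right_mono) auto
      also have "\<dots> = u m / real m + K / real n"
        using that by (simp add: add_divide_distrib)
      finally show ?thesis .
    qed
    obtain N :: nat where N: "2 * K / e < real N" using reals_Archimedean2 by blast
    show "\<exists>no. \<forall>n\<ge>no. norm (u n / real n - L) < e"
    proof (intro exI allI impI)
      fix n assume "max 1 N \<le> n"
      then have n: "1 \<le> n" "real N \<le> real n" by auto
      have "2 * K < e * real N" using N \<open>0 < e\<close> by (simp add: field_simps)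
      also have "\<dots> \<le> e * real n" using n \<open>0 < e\<close> by (intro mult_left_mono) auto
      finally have "K / real n < e / 2" using n(1) by (simp add: field_simps)
      then show "norm (u n / real n - L) < e"
        unfolding real_norm_def using upper[OF n(1)] L_le[OF n(1)] m(2) by linarith
    qed
  qed
  then show ?thesis by (rule convergentI)
qed

lemma log_ratio_convergent:
  fixes W :: "nat \<Rightarrow> ennreal"
  assumes lower: "\<And>n. ennreal (2 powr - real n) \<le> W n" and fin: "\<And>n. W n < \<infinity>"
    and sub: "\<And>m n. W (m + n) \<le> W m * W n"
  shows "convergent (\<lambda>n. log 2 (enn2real (W n)) / real n)"
proof (rule subadditive_ratio_convergent)
  have ge: "2 powr - real n \<le> enn2real (W n)" for n
    using enn2real_mono[OF lower[of n]] fin[of n] by simp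
  have pos: "0 < enn2real (W n)" for n
    using ge[of n] by (rule less_le_trans[rotated]) simp
  show "- (1 * real n) \<le> log 2 (enn2real (W n))" for n
    using ge[of n] pos[of n] by (simp add: le_log_iff)
  show "log 2 (enn2real (W (m + n))) \<le> log 2 (enn2real (W m)) + log 2 (enn2real (W n))" for m n
  proof -
    have "enn2real (W (m + n)) \<le> enn2real (W m) * enn2real (W n)"
      using enn2real_mono[OF sub[of m n]] fin[of m] fin[of n]
      by (simp add: ennreal_mult_less_top enn2real_mult)
    then show ?thesis using pos[of m] pos[of n] pos[of "m + n"] by (simp flip: log_mult_pos)
  qed
qed

text \<open>
  The two logarithms differ by at most \<open>log c\<close>, which disappears after division by \<open>n\<close>.
\<close>

lemma log_ratio_tendsto_transfer:
  fixes W W' :: "nat \<Rightarrow> ennreal"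
  assumes "0 < c" and le: "\<And>n. W n \<le> ennreal c * W' n" "\<And>n. W' n \<le> ennreal c * W n"
    and pos: "\<And>n. 0 < W n" "\<And>n. 0 < W' n" and fin: "\<And>n. W n < \<infinity>" "\<And>n. W' n < \<infinity>"
    and lim: "(\<lambda>n. log 2 (enn2real (W n)) / real n) \<longlonglongrightarrow> l"
  shows "(\<lambda>n. log 2 (enn2real (W' n)) / real n) \<longlonglongrightarrow> l"
proof -
  have pos': "0 < enn2real (W n)" "0 < enn2real (W' n)" for n
    using pos fin by (simp_all add: enn2real_positive_iff)
  have log_le: "log 2 (enn2real U) \<le> log 2 c + log 2 (enn2real V)"
    if "U \<le> ennreal c * V" "V < \<infinity>" "0 < enn2real U" "0 < enn2real V" for U V
  proof -
    have "enn2real U \<le> c * enn2real V"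
      using enn2real_mono[OF that(1)] that(2) \<open>0 < c\<close> by (simp add: ennreal_mult_less_top enn2real_mult)
    then show ?thesis using that \<open>0 < c\<close> by (simp flip: log_mult_pos)
  qed
  have "(\<lambda>n. log 2 (enn2real (W' n)) / real n - log 2 (enn2real (W n)) / real n) \<longlonglongrightarrow> 0"
  proof (rule Lim_null_comparison)
    show "(\<lambda>n. log 2 c / real n) \<longlonglongrightarrow> 0" by (rule lim_const_over_n)
    have "\<bar>log 2 (enn2real (W' n)) - log 2 (enn2real (W n))\<bar> / real n \<le> log 2 c / real n" for n
      using log_le[OF le(1) fin(2) pos'] log_le[OF le(2) fin(1) pos'(2,1)]
      by (intro divide_right_mono) (auto simp: abs_le_iff algebra_simps)
    then show "\<forall>\<^sub>F n in sequentially.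
        norm (log 2 (enn2real (W' n)) / real n - log 2 (enn2real (W n)) / real n) \<le> log 2 c / real n"
      by (intro always_eventually) (simp flip: diff_divide_distrib)
  qed
  from tendsto_add[OF this lim] show ?thesis by simp
qed

lemma exponents_comparable:
  assumes ex: "exponents_exist w" and "0 < c"
    and le: "\<And>n. w n \<le> ennreal c * w' n" "\<And>n. w' n \<le> ennreal c * w n"
  shows "exponents_exist w'" "lower_exponent w' = lower_exponent w" "upper_exponent w' = upper_exponent w"
proof -
  have w: "0 < w n" "w n < \<infinity>" for n using ex by (simp_all add: exponents_exist_def)
  have w': "0 < w' n" for n
    using le(1)[of n] w(1)[of n] by (cases "w' n = 0") (auto simp: zero_less_iff_neq_zero)
  have w'_fin: "w' n < \<infinity>" for n
    using le(2)[of n] by (rule le_less_trans) (use w(2)[of n] in \<open>simp add: ennreal_mult_less_top\<close>)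
  obtain l1 l2 where l: "(\<lambda>n. log 2 (enn2real (w (- int n))) / real n) \<longlonglongrightarrow> l1"
      "(\<lambda>n. log 2 (enn2real (w (int n))) / real n) \<longlonglongrightarrow> l2"
    using ex by (auto simp: exponents_exist_def convergent_def)
  have l': "(\<lambda>n. log 2 (enn2real (w' (- int n))) / real n) \<longlonglongrightarrow> l1"
      "(\<lambda>n. log 2 (enn2real (w' (int n))) / real n) \<longlonglongrightarrow> l2"
    by (rule log_ratio_tendsto_transfer[OF \<open>0 < c\<close> le w(1) w' w(2) w'_fin], rule l)+
  show "exponents_exist w'"
    using w' w'_fin l' by (auto simp: exponents_exist_def convergent_def)
  show "lower_exponent w' = lower_exponent w" "upper_exponent w' = upper_exponent w"
    using l l' by (simp_all add: lower_exponent_def upper_exponent_def limI)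
qed

section \<open>Exponents of truncated shifts\<close>

lemma shift_norm_eq_trunc: "shift_norm = trunc_shift_norm UNIV"
proof -
  have "trunc_shift UNIV = shift"
    by (auto simp: trunc_shift_def shift_def fun_eq_iff)
  then show ?thesis by (simp add: shift_norm_def[abs_def] trunc_shift_norm_def[abs_def])
qed

context ri_space
begin

text \<open>
  Truncation only decreases absolute values, so this is the bound for the full shift, whose distribution
  function is \<open>2\<^sup>n d\<^sub>a\<close>.
\<close>

lemma trunc_shift_bounded:
  assumes "a \<in> seq_space X"
  shows "trunc_shift A n a \<in> seq_space X" "seq_norm nrm (trunc_shift A n a) \<le> 2 ^ nat n * seq_norm nrm a"
proof -
  have "distr_fun (step_fun (trunc_shift A n a)) \<tau> \<le> 2 ^ nat n * distr_fun (step_fun a) \<tau>" for \<tau>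
  proof -
    have "distr_fun (step_fun (trunc_shift A n a)) \<tau> \<le> distr_fun (step_fun (shift n a)) \<tau>"
      by (intro distr_fun_mono step_fun_measurable AE_I2)
        (auto simp: step_fun_eq trunc_shift_def shift_def indicator_def)
    also have "\<dots> = ennreal (2 powi n) * distr_fun (step_fun a) \<tau>"
      by (simp add: step_fun_shift distr_fun_dilation)
    also have "\<dots> \<le> ennreal (2 ^ nat n) * distr_fun (step_fun a) \<tau>"
      by (intro mult_right_mono ennreal_leI) (auto simp: power_int_def power_inverse[symmetric] power_le_one)
    finally show ?thesis by (simp add: ennreal_power[symmetric])
  qed
  then show "trunc_shift A n a \<in> seq_space X" "seq_norm nrm (trunc_shift A n a) \<le> 2 ^ nat n * seq_norm nrm a"
    using step_fun_norm_le_power[of "step_fun a" "trunc_shift A n a" "nat n"] assms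
    by (simp_all add: mem_seq_space seq_norm_def)
qed

lemma trunc_shift_norm_finite: "trunc_shift_norm A (seq_space X) (seq_norm nrm) n < \<infinity>"
proof -
  have "trunc_shift_norm A (seq_space X) (seq_norm nrm) n \<le> ennreal (2 ^ nat n)"
    unfolding trunc_shift_norm_def op_norm_on_def
  proof (rule SUP_least, clarify)
    fix a assume a: "a \<in> seq_space X" "seq_norm nrm a \<noteq> 0"
    then have "seq_norm nrm (trunc_shift A n a) / seq_norm nrm a \<le> 2 ^ nat n"
      using trunc_shift_bounded(2)[of a A n] seq_norm_nonneg[of a] by (simp add: divide_le_eq)
    then show "(if trunc_shift A n a \<in> seq_space X
        then ennreal (seq_norm nrm (trunc_shift A n a) / seq_norm nrm a) else \<infinity>) \<le> ennreal (2 ^ nat n)"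
      using trunc_shift_bounded(1)[OF a(1)] by (simp only: if_True ennreal_leI)
  qed
  then show ?thesis by (rule le_less_trans) simp
qed

lemma ratio_le_trunc_shift_norm:
  assumes "a \<in> seq_space X" "seq_norm nrm a \<noteq> 0"
  shows "ennreal (seq_norm nrm (trunc_shift A n a) / seq_norm nrm a)
    \<le> trunc_shift_norm A (seq_space X) (seq_norm nrm) n"
  using assms trunc_shift_bounded(1)[of a A n]
  unfolding trunc_shift_norm_def op_norm_on_def by (intro SUP_upper2[of a]) auto

lemma trunc_shift_norm_submult:
  assumes comp: "\<And>a. trunc_shift A (m + n) a = trunc_shift A m (trunc_shift A n a)"
  shows "trunc_shift_norm A (seq_space X) (seq_norm nrm) (m + n)
    \<le> trunc_shift_norm A (seq_space X) (seq_norm nrm) m * trunc_shift_norm A (seq_space X) (seq_norm nrm) n"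
    (is "_ \<le> ?w m * ?w n")
  unfolding trunc_shift_norm_def[of _ _ _ "m + n"] op_norm_on_def
proof (rule SUP_least, clarify)
  fix a assume a: "a \<in> seq_space X" "seq_norm nrm a \<noteq> 0"
  define b where "b = trunc_shift A n a"
  have b: "b \<in> seq_space X" using trunc_shift_bounded(1)[OF a(1)] by (simp add: b_def)
  have Tb: "trunc_shift A m b \<in> seq_space X" using trunc_shift_bounded(1)[OF b] .
  have "ennreal (seq_norm nrm (trunc_shift A m b) / seq_norm nrm a) \<le> ?w m * ?w n"
  proof (cases "seq_norm nrm b = 0")
    case True
    then have "seq_norm nrm (trunc_shift A m b) = 0"
      using trunc_shift_bounded(2)[OF b, of A m] seq_norm_nonneg[OF Tb] by simp
    then show ?thesis by simp
  next
    case False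
    then have "ennreal (seq_norm nrm (trunc_shift A m b) / seq_norm nrm a)
        = ennreal (seq_norm nrm (trunc_shift A m b) / seq_norm nrm b) * ennreal (seq_norm nrm b / seq_norm nrm a)"
      using seq_norm_nonneg[OF b] seq_norm_nonneg[OF a(1)] seq_norm_nonneg[OF Tb]
      by (simp flip: ennreal_mult)
    also have "\<dots> \<le> ?w m * ?w n"
      using ratio_le_trunc_shift_norm[OF b False, of A m] ratio_le_trunc_shift_norm[OF a, of A n]
      by (intro mult_mono) (auto simp: b_def)
    finally show ?thesis .
  qed
  then show "(if trunc_shift A (m + n) a \<in> seq_space X
      then ennreal (seq_norm nrm (trunc_shift A (m + n) a) / seq_norm nrm a) else \<infinity>) \<le> ?w m * ?w n"
    using Tb by (simp add: comp b_def)
qed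

text \<open>
  The indicator of \<open>\<Delta>\<^bsub>-1\<^esub> = [1/2, 1)\<close> is below that of \<open>[0,1]\<close>, and the shifts carry it to every \<open>\<Delta>\<^sub>j\<close>.
\<close>

lemma unit_seq:
  fixes j defines "e \<equiv> \<lambda>k. if k = j then 1 else 0"
  assumes ind: "indicator {0..1} \<in> X"
  shows "e \<in> seq_space X" "seq_norm nrm e \<noteq> 0"
proof -
  define e' :: "int \<Rightarrow> real" where "e' = (\<lambda>k. if k = -1 then 1 else 0)"
  have "\<bar>step_fun e' t\<bar> \<le> \<bar>indicator {0..1} t\<bar>" for t
  proof (cases "0 < t \<and> \<lfloor>log 2 t\<rfloor> = -1")
    case True
    then have "\<lfloor>log 2 t\<rfloor> < 0" by simp
    then have "t < 2 powi 0" using True floor_log_less_iff by blast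
    then show ?thesis using True by (simp add: step_fun_eq e'_def)
  qed (auto simp: step_fun_eq e'_def)
  then have "step_fun e' \<in> X"
    using ideal[OF ind step_fun_measurable] by simp
  then have "e' \<in> seq_space X" by (simp add: mem_seq_space)
  moreover have "e = trunc_shift UNIV (j + 1) e'"
    by (auto simp: e_def e'_def trunc_shift_def shift_def fun_eq_iff)
  ultimately show "e \<in> seq_space X" using trunc_shift_bounded(1) by simp
  then have "step_fun e \<in> X" by (simp add: mem_seq_space)
  moreover have "ennreal (2 powi j) \<le> distr_fun (step_fun e) 0"
    by (rule measure_dyadic_le_distr_fun) (simp add: e_def)
  ultimately show "seq_norm nrm e \<noteq> 0"
    by (auto simp: seq_norm_def nrm_eq_0_iff_distr_fun)
qed

text \<open>
  The unit sequence at \<open>j\<close> is mapped to the one at \<open>j + n\<close>, and the shift back has norm at most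
  \<open>2\<^bsup>max(0,-n)\<^esup>\<close>.
\<close>

lemma trunc_shift_norm_ge:
  assumes ind: "indicator {0..1} \<in> X" and j: "j \<in> A" "j + n \<in> A"
  shows "ennreal (1 / 2 ^ nat (- n)) \<le> trunc_shift_norm A (seq_space X) (seq_norm nrm) n"
proof -
  define e :: "int \<Rightarrow> int \<Rightarrow> real" where "e j = (\<lambda>k. if k = j then 1 else 0)" for j
  have e: "e j \<in> seq_space X" "seq_norm nrm (e j) \<noteq> 0" for j
    unfolding e_def by (rule unit_seq[OF ind])+
  have sh: "trunc_shift A n (e j) = e (j + n)"
    using j by (auto simp: e_def trunc_shift_def shift_def indicator_def fun_eq_iff)
  have inverse_shift: "trunc_shift UNIV (- n) (e (j + n)) = e j"
    by (auto simp: e_def trunc_shift_def shift_def fun_eq_iff)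
  have "seq_norm nrm (e j) \<le> 2 ^ nat (- n) * seq_norm nrm (e (j + n))"
    using trunc_shift_bounded(2)[OF e(1), of UNIV "- n" "j + n"] by (simp add: inverse_shift)
  moreover have "0 < seq_norm nrm (e j)"
    using e[of j] seq_norm_nonneg[of "e j"] by simp
  ultimately have "1 / 2 ^ nat (- n) \<le> seq_norm nrm (e (j + n)) / seq_norm nrm (e j)"
    by (simp add: field_simps)
  then have "ennreal (1 / 2 ^ nat (- n)) \<le> ennreal (seq_norm nrm (e (j + n)) / seq_norm nrm (e j))"
    by (rule ennreal_leI)
  also have "\<dots> \<le> trunc_shift_norm A (seq_space X) (seq_norm nrm) n"
    using ratio_le_trunc_shift_norm[OF e, of A n j] by (simp add: sh)
  finally show ?thesis .
qed

text \<open>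
  Order convexity of the index set gives the composition law for shifts in the same direction: the
  intermediate index \<open>k - m\<close> lies between \<open>k\<close> and \<open>k - m - n\<close>. With the second condition no truncated shift
  is zero, and its norm is at least \<open>2\<^bsup>-|n|\<^esup>\<close>.
\<close>

lemma trunc_shift_exponents_exist:
  assumes ind: "indicator {0..1} \<in> X"
    and convex: "\<And>x y z. \<lbrakk>x \<in> A; z \<in> A; x \<le> y; y \<le> z\<rbrakk> \<Longrightarrow> y \<in> A"
    and large: "\<And>n. \<exists>j\<in>A. j + n \<in> A"
  shows "exponents_exist (trunc_shift_norm A (seq_space X) (seq_norm nrm))" (is "exponents_exist ?w")
proof -
  have ge: "ennreal (1 / 2 ^ nat (- n)) \<le> ?w n" for n
    using large[of n] trunc_shift_norm_ge[OF ind] by blast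
  have pos: "0 < ?w n" for n
    using ge[of n] by (rule less_le_trans[rotated]) simp
  have sub: "?w (m + n) \<le> ?w m * ?w n" if "0 \<le> m \<and> 0 \<le> n \<or> m \<le> 0 \<and> n \<le> 0" for m n
  proof (rule trunc_shift_norm_submult)
    fix a
    have "k - m \<in> A" if "k \<in> A" "k - (m + n) \<in> A" for k
      using convex[OF that, of "k - m"] convex[OF that(2,1), of "k - m"]
        \<open>0 \<le> m \<and> 0 \<le> n \<or> m \<le> 0 \<and> n \<le> 0\<close> by linarith
    then show "trunc_shift A (m + n) a = trunc_shift A m (trunc_shift A n a)"
      by (auto simp: trunc_shift_def shift_def indicator_def fun_eq_iff algebra_simps)
  qed
  have ge': "ennreal (2 powr - real k) \<le> ?w (s * int k)" if "\<bar>s\<bar> = 1" for k s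
  proof -
    have "2 powr - real k \<le> 1 / 2 ^ nat (- (s * int k))"
    proof -
      have "nat (- (s * int k)) \<le> k" using that by (auto simp: abs_if split: if_splits)
      then have "(2::real) ^ nat (- (s * int k)) \<le> 2 ^ k" by (intro power_increasing) auto
      then show ?thesis by (simp add: powr_minus powr_realpow field_simps)
    qed
    then show ?thesis using ge[of "s * int k"] ennreal_leI order_trans by blast
  qed
  have conv: "convergent (\<lambda>k. log 2 (enn2real (?w (s * int k))) / real k)" if "\<bar>s\<bar> = 1" for s
  proof (rule log_ratio_convergent)
    fix m k
    have "s = 1 \<or> s = -1" using that by (auto simp: abs_if split: if_splits)
    then show "?w (s * int (m + k)) \<le> ?w (s * int m) * ?w (s * int k)"
      using sub[of "s * int m" "s * int k"] by (auto simp: distrib_left)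
  qed (use ge'[OF that] trunc_shift_norm_finite in auto)
  show ?thesis
    using conv[of 1] conv[of "-1"] pos trunc_shift_norm_finite by (simp add: exponents_exist_def)
qed

end

section \<open>Comparison of dilation indices and shift exponents\<close>

theorem proposition7:
  fixes X :: "(real \<Rightarrow> real) set" and nrm :: "(real \<Rightarrow> real) \<Rightarrow> real"
    and E :: "(int \<Rightarrow> real) set" and nrmE :: "(int \<Rightarrow> real) \<Rightarrow> real"
  assumes ri: "ri_space X nrm"
    and separable_or_fatou: "separable_norm X nrm \<or> fatou_property X nrm"
    and normalized: "indicator {0..1} \<in> X" "nrm (indicator {0..1}) = 1"
    and E_def: "E = seq_space X" and nrmE_def: "nrmE = seq_norm nrm"
  shows "(\<forall>n::int. shift_norm E nrmE n \<le> dil_norm X nrm n \<and>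
               dil_norm X nrm n \<le> 2 * shift_norm E nrmE n) \<and>
    (\<forall>n::int. shift_neg_norm E nrmE n \<le> dil0_norm X nrm n \<and>
               dil0_norm X nrm n \<le> 2 * shift_neg_norm E nrmE n \<and>
               shift0_norm E nrmE n / 2 \<le> dil0_norm X nrm n \<and>
               dil0_norm X nrm n \<le> 2 * shift0_norm E nrmE n) \<and>
    (\<forall>n::int. shift_inf_norm E nrmE n / 2 \<le> dil_inf_norm X nrm n \<and>
               dil_inf_norm X nrm n \<le> 4 * shift_inf_norm E nrmE n) \<and>
    exponents_exist (dil_norm X nrm) \<and>
    exponents_exist (shift_norm E nrmE) \<and>
    exponents_exist (dil0_norm X nrm) \<and>
    exponents_exist (shift0_norm E nrmE) \<and>
    exponents_exist (dil_inf_norm X nrm) \<and>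
    exponents_exist (shift_inf_norm E nrmE) \<and>
    alpha_index X nrm = gamma_exp E nrmE \<and>
    alpha0_index X nrm = gamma0_exp E nrmE \<and>
    alpha_inf_index X nrm = gamma_inf_exp E nrmE \<and>
    beta_index X nrm = delta_exp E nrmE \<and>
    beta0_index X nrm = delta0_exp E nrmE \<and>
    beta_inf_index X nrm = delta_inf_exp E nrmE"
proof -
  interpret ri_space X nrm by (rule ri)
  have half: "u / 2 \<le> v" if "u \<le> 2 * v" for u v :: ennreal
  proof -
    have "u / 2 \<le> (2 * v) / 2" using that by (rule divide_right_mono_ennreal)
    also have "\<dots> = v"
      by (subst mult_divide_eq_ennreal[of 2 v, symmetric]) (auto simp: mult.commute)
    finally show ?thesis .
  qed
  have le_mult: "v \<le> ennreal c * v" if "1 \<le> c" for c and v :: ennreal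
    using mult_right_mono[OF ennreal_leI[OF that], of v] by simp
  have neg_sub: "{..<0} \<subseteq> {..0::int}" by auto
  note i = shift_norm_le_dil_norm dil_norm_le_shift_norm
  note ii = shift_neg_norm_le_dil0_norm dil0_norm_le_trunc_shift_norm[of "{..<0}", OF subset_refl]
    shift0_norm_le_dil0_norm dil0_norm_le_trunc_shift_norm[of "{..0}", OF neg_sub]
  note iii = shift_inf_norm_le_dil_inf_norm dil_inf_norm_le_shift_inf_norm
  have norms:
    "\<forall>n. shift_norm E nrmE n \<le> dil_norm X nrm n \<and> dil_norm X nrm n \<le> 2 * shift_norm E nrmE n"
    "\<forall>n. shift_neg_norm E nrmE n \<le> dil0_norm X nrm n \<and>
        dil0_norm X nrm n \<le> 2 * shift_neg_norm E nrmE n \<and>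
        shift0_norm E nrmE n / 2 \<le> dil0_norm X nrm n \<and>
        dil0_norm X nrm n \<le> 2 * shift0_norm E nrmE n"
    "\<forall>n. shift_inf_norm E nrmE n / 2 \<le> dil_inf_norm X nrm n \<and>
        dil_inf_norm X nrm n \<le> 4 * shift_inf_norm E nrmE n"
  proof -
    have "shift_inf_norm E nrmE n / 2 \<le> dil_inf_norm X nrm n" for n
      using iii(1)[of n] le_mult[of 2 "dil_inf_norm X nrm n"]
      by (intro half) (auto simp: E_def nrmE_def intro: order_trans)
    then show "\<forall>n. shift_inf_norm E nrmE n / 2 \<le> dil_inf_norm X nrm n \<and>
        dil_inf_norm X nrm n \<le> 4 * shift_inf_norm E nrmE n"
      using iii(2) by (simp add: E_def nrmE_def)
  qed (use i ii half in \<open>auto simp: E_def nrmE_def\<close>)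
  have large: "\<exists>j\<in>{..0}. j + n \<in> {..0}" "\<exists>j\<in>{0..}. j + n \<in> {0..}" for n :: int
    by (rule bexI[of _ "- \<bar>n\<bar>"]; simp) (rule bexI[of _ "\<bar>n\<bar>"]; simp)
  have shifts: "exponents_exist (shift_norm E nrmE)" "exponents_exist (shift0_norm E nrmE)"
      "exponents_exist (shift_inf_norm E nrmE)"
    unfolding E_def nrmE_def shift_norm_eq_trunc
    by (rule trunc_shift_exponents_exist[OF normalized(1)]; use large in auto)+
  note cmp = exponents_comparable[OF shifts(1), of 2 "dil_norm X nrm"]
    exponents_comparable[OF shifts(2), of 2 "dil0_norm X nrm"]
    exponents_comparable[OF shifts(3), of 4 "dil_inf_norm X nrm"]
  have le: "shift_norm E nrmE n \<le> ennreal 2 * dil_norm X nrm n"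
      "dil_norm X nrm n \<le> ennreal 2 * shift_norm E nrmE n"
      "shift0_norm E nrmE n \<le> ennreal 2 * dil0_norm X nrm n"
      "dil0_norm X nrm n \<le> ennreal 2 * shift0_norm E nrmE n"
      "shift_inf_norm E nrmE n \<le> ennreal 4 * dil_inf_norm X nrm n"
      "dil_inf_norm X nrm n \<le> ennreal 4 * shift_inf_norm E nrmE n" for n
    using order_trans[OF i(1)[of n] le_mult[of 2]] i(2)[of n] ii(3)[of n] ii(4)[of n]
      order_trans[OF iii(1)[of n] le_mult[of 4]] iii(2)[of n]
    by (simp_all add: E_def nrmE_def)
  show ?thesis
    using norms shifts cmp le
    by (simp add: alpha_index_def beta_index_def alpha0_index_def beta0_index_def
        alpha_inf_index_def beta_inf_index_def gamma_exp_def delta_exp_def gamma0_exp_def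
        delta0_exp_def gamma_inf_exp_def delta_inf_exp_def)
qed

end
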